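(* If $\delta\approx h^2$ is sufficiently small, then the solution of the backward Euler system is unique; that is, for each $n=0,\dots,n_i-1$, the solution $\mathbf V^{(n+1)}=(V_1^{(n+1)},\dots,V_{n_e}^{(n+1)})\in(S_h^k)^{n_e}$ of $$\left(\frac{V_i^{(n+1)}-V_i^{(n)}}{\delta},W_i\right)+b_2^{(n+1)}a_i^{(n+1)}\left(\frac{\partial V_i^{(n+1)}}{\partial y},\frac{\partial W_i}{\partial y}\right)-\left(b_1^{(n+1)}\frac{\partial V_i^{(n+1)}}{\partial y},W_i\right)=(g_i^{(n+1)},W_i)$$ for all $W_i\in S_h^k$, $i=1,\dots,n_e$, where $a_i^{(n+1)}=a_i\big(l^{(n+1)}(V_1^{(n+1)}),\dots,l^{(n+1)}(V_{n_e}^{(n+1)})\big)$, is unique.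
   Context: Let $n_e\ge1$ be an integer and $T>0$. Let $\alpha,\beta\in\mathcal C^2([0,T])$ with $\alpha',\beta'\in L_2(]0,T[)$, put $\gamma=\beta-\alpha$, and assume $0<\gamma_0<\gamma(t)<\gamma_1<\infty$, $|\gamma'(t)|\le\gamma'_{\max}$ and $|\alpha'(t)|\le\alpha'_{\max}$ for all $t\in[0,T]$. Put $\Omega_t=]\alpha(t),\beta(t)[$ and $\Omega=]0,1[$. For $i=1,\dots,n_e$: $u_{i0}\in H_0^1(\Omega_0)$; $f_i$ satisfies $\int_0^T\int_{\Omega_t}f_i^2\,dx\,dt<\infty$; $a_i:\mathbb R^{n_e}\to\mathbb R^+$ is Lipschitz-continuous with $0<m_a\le a_i(s)\le M_a$ for all $s\in\mathbb R^{n_e}$. Notation: $b_1(y,t)=\dfrac{\alpha'(t)+\gamma'(t)y}{\gamma(t)}$, $b_2(t)=\dfrac1{\gamma(t)^2}$, $g_i(y,t)=f_i(\alpha(t)+\gamma(t)y,t)$, $v_{i0}(y)=u_{i0}(\alpha(0)+\gamma(0)y)$. Time is discretised with step $\delta>0$, $t_n=n\delta$, $n=0,\dots,n_i$, $T=n_i\delta$. A superscript $(n)$ on a given function denotes its value at $t_n$, so $b_1^{(n)}=b_1(\cdot,t_n)$, $b_2^{(n)}=b_2(t_n)$, $g_i^{(n)}=g_i(\cdot,t_n)$, and $l^{(n)}(w)=\gamma(t_n)\int_0^1w(y)\,dy$. $(\cdot,\cdot)$ is the inner product of $L_2(\Omega)$. $\mathcal T_h$ is a partition of $\Omega$ into disjoint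 intervals of maximal length $h$; $S_h^k$ is the space of continuous functions on $[0,1]$ that vanish at $0$ and $1$ and are polynomials of degree $k$ on each interval of $\mathcal T_h$; $I_h$ is the Lagrange interpolation operator onto $S_h^k$. The scheme starts from $V_i^{(0)}=I_hv_{i0}$, and $\mathbf V^{(n)}$ is given by the previous steps. The scheme discretises, for $i=1,\dots,n_e$, the problem $\partial_tv_i-a_i(l(v_1),\dots,l(v_{n_e}))\,b_2\,\partial_y^2v_i-b_1\partial_yv_i=g_i$ in $]0,1[\times]0,T[$, $v_i(0,t)=v_i(1,t)=0$, $v_i(\cdot,0)=v_{i0}$, where $l(v)=\gamma(t)\int_0^1v(y,t)\,dy$.
   Formalization: Added assumption: the values g_i(·,t_n) at the grid times lie in L_2(0,1) and δ Σ_n ‖g_i^{(n)}‖² is bounded uniformly in δ = T/N; square integrability of f_i alone does not control these values, and uniqueness can then fail. *)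

theory Defs
  imports "HOL-Analysis.Analysis" "HOL-Computational_Algebra.Polynomial"
begin

section \<open>Function spaces\<close>

definition L2_on :: "'a::euclidean_space set \<Rightarrow> ('a \<Rightarrow> real) \<Rightarrow> bool" where
  "L2_on S f \<longleftrightarrow> set_borel_measurable lebesgue S f \<and> set_integrable lebesgue S (\<lambda>x. (f x)\<^sup>2)"

definition test_function :: "real \<Rightarrow> real \<Rightarrow> (real \<Rightarrow> real) \<Rightarrow> bool" where
  "test_function a b \<phi> \<longleftrightarrow>
     (\<forall>m x. ((deriv ^^ m) \<phi>) differentiable (at x)) \<and> closure {x. \<phi> x \<noteq> 0} \<subseteq> {a<..<b}"

text \<open>The closure of the test functions in the \<open>H\<^sup>1\<close> norm. An element is represented by its
  continuous representative on the closed interval, since point values are needed for the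
  Lagrange interpolation; \<open>w\<close> is the weak derivative.\<close>

definition H10 :: "real \<Rightarrow> real \<Rightarrow> (real \<Rightarrow> real) set" where
  "H10 a b = {u. continuous_on {a..b} u \<and>
     (\<exists>w \<phi>. L2_on {a<..<b} w \<and> (\<forall>m::nat. test_function a b (\<phi> m)) \<and>
       (\<lambda>m. LINT x:{a<..<b}|lebesgue. (\<phi> m x - u x)\<^sup>2) \<longlonglongrightarrow> 0 \<and>
       (\<lambda>m. LINT x:{a<..<b}|lebesgue. (deriv (\<phi> m) x - w x)\<^sup>2) \<longlonglongrightarrow> 0)}"

definition L2_inner :: "(real \<Rightarrow> real) \<Rightarrow> (real \<Rightarrow> real) \<Rightarrow> real" where
  "L2_inner u v = (LINT y:{0<..<1}|lebesgue. u y * v y)"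

text \<open>Derivatives in time are taken within \<open>[0,T]\<close>, hence one-sided at the end points.\<close>

definition Dt :: "real \<Rightarrow> (real \<Rightarrow> real) \<Rightarrow> real \<Rightarrow> real" where
  "Dt T f t = vector_derivative f (at t within {0..T})"

definition C2_on :: "real \<Rightarrow> (real \<Rightarrow> real) \<Rightarrow> bool" where
  "C2_on T f \<longleftrightarrow> f differentiable_on {0..T} \<and> Dt T f differentiable_on {0..T} \<and>
     continuous_on {0..T} (Dt T (Dt T f))"

section \<open>Transformed data\<close>

definition width :: "(real \<Rightarrow> real) \<Rightarrow> (real \<Rightarrow> real) \<Rightarrow> real \<Rightarrow> real" where
  "width \<alpha> \<beta> t = \<beta> t - \<alpha> t"

definition coeff_b1 :: "real \<Rightarrow> (real \<Rightarrow> real) \<Rightarrow> (real \<Rightarrow> real) \<Rightarrow> real \<Rightarrow> real \<Rightarrow> real" where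
  "coeff_b1 T \<alpha> \<beta> y t = (Dt T \<alpha> t + Dt T (width \<alpha> \<beta>) t * y) / width \<alpha> \<beta> t"

definition coeff_b2 :: "(real \<Rightarrow> real) \<Rightarrow> (real \<Rightarrow> real) \<Rightarrow> real \<Rightarrow> real" where
  "coeff_b2 \<alpha> \<beta> t = 1 / (width \<alpha> \<beta> t)\<^sup>2"

definition source_g ::
    "(real \<Rightarrow> real) \<Rightarrow> (real \<Rightarrow> real) \<Rightarrow> (real \<Rightarrow> real \<Rightarrow> real) \<Rightarrow> real \<Rightarrow> real \<Rightarrow> real" where
  "source_g \<alpha> \<beta> f y t = f (\<alpha> t + width \<alpha> \<beta> t * y) t"

definition init_v :: "(real \<Rightarrow> real) \<Rightarrow> (real \<Rightarrow> real) \<Rightarrow> (real \<Rightarrow> real) \<Rightarrow> real \<Rightarrow> real" where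
  "init_v \<alpha> \<beta> u0 y = u0 (\<alpha> 0 + width \<alpha> \<beta> 0 * y)"

definition nonlocal_l ::
    "(real \<Rightarrow> real) \<Rightarrow> (real \<Rightarrow> real) \<Rightarrow> real \<Rightarrow> (real \<Rightarrow> real) \<Rightarrow> real" where
  "nonlocal_l \<alpha> \<beta> t w = width \<alpha> \<beta> t * (LINT y:{0<..<1}|lebesgue. w y)"

text \<open>Square integrability in space-time does not determine the values \<open>g(\<cdot>,t\<^sub>n)\<close>, which the
  scheme uses. The following makes these values meaningful: at the grid times they are in \<open>L\<^sub>2\<close>,
  and the discrete counterpart of the space-time \<open>L\<^sub>2\<close> norm is bounded uniformly in the time step
  \<open>T/N\<close>. It holds whenever \<open>t \<mapsto> g(\<cdot>,t)\<close> is bounded in \<open>L\<^sub>2\<close>, in particular when it is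
  continuous into \<open>L\<^sub>2\<close> on \<open>[0,T]\<close>.\<close>

definition L2_time_samples :: "real \<Rightarrow> (real \<Rightarrow> real \<Rightarrow> real) \<Rightarrow> bool" where
  "L2_time_samples T g \<longleftrightarrow>
     (\<forall>N::nat. \<forall>n\<in>{1..N}. L2_on {0<..<1} (\<lambda>y. g y (real n * (T / real N)))) \<and>
     (\<exists>K. \<forall>N::nat. (\<Sum>n=1..N. T / real N *
        (LINT y:{0<..<1}|lebesgue. (g y (real n * (T / real N)))\<^sup>2)) \<le> K)"

section \<open>Finite elements\<close>

text \<open>The mesh has the elements \<open>[x j, x (j+1)]\<close>, \<open>j < M\<close>.\<close>

definition mesh :: "nat \<Rightarrow> (nat \<Rightarrow> real) \<Rightarrow> bool" where
  "mesh M x \<longleftrightarrow> 1 \<le> M \<and> x 0 = 0 \<and> x M = 1 \<and> (\<forall>j<M. x j < x (Suc j))"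

definition mesh_size :: "nat \<Rightarrow> (nat \<Rightarrow> real) \<Rightarrow> real" where
  "mesh_size M x = Max ((\<lambda>j. x (Suc j) - x j) ` {..<M})"

text \<open>Members are only determined on \<open>[0,1]\<close>; their values outside are irrelevant.\<close>

definition fe_space :: "nat \<Rightarrow> nat \<Rightarrow> (nat \<Rightarrow> real) \<Rightarrow> (real \<Rightarrow> real) set" where
  "fe_space k M x = {V. continuous_on {0..1} V \<and> V 0 = 0 \<and> V 1 = 0 \<and>
     (\<forall>j<M. \<exists>p::real poly. degree p \<le> k \<and> (\<forall>y\<in>{x j..x (Suc j)}. V y = poly p y))}"

text \<open>Lagrange nodes of degree \<open>k\<close> on the reference element \<open>[0,1]\<close>, end points included;
  the usual choice is \<open>\<xi> r = r / k\<close>.\<close>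

definition lagrange_nodes :: "nat \<Rightarrow> (nat \<Rightarrow> real) \<Rightarrow> bool" where
  "lagrange_nodes k \<xi> \<longleftrightarrow> \<xi> 0 = 0 \<and> \<xi> k = 1 \<and> (\<forall>r<k. \<xi> r < \<xi> (Suc r))"

definition lagrange_interpolant ::
    "nat \<Rightarrow> (nat \<Rightarrow> real) \<Rightarrow> nat \<Rightarrow> (nat \<Rightarrow> real) \<Rightarrow> (real \<Rightarrow> real) \<Rightarrow> (real \<Rightarrow> real) \<Rightarrow> bool" where
  "lagrange_interpolant k \<xi> M x v V \<longleftrightarrow> V \<in> fe_space k M x \<and>
     (\<forall>j<M. \<forall>r\<le>k. V (x j + \<xi> r * (x (Suc j) - x j)) = v (x j + \<xi> r * (x (Suc j) - x j)))"

section \<open>Backward Euler step\<close>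

text \<open>\<open>Vn\<close> is the solution at \<open>t\<^sub>n\<close> and \<open>V\<close> a solution at \<open>t\<^sub>n\<^sub>+\<^sub>1\<close>. On \<open>]0,1[\<close> without the
  mesh points, \<^const>\<open>deriv\<close> is the elementwise derivative of a finite element function,
  which is its weak derivative.\<close>

definition euler_step ::
    "real \<Rightarrow> (real \<Rightarrow> real) \<Rightarrow> (real \<Rightarrow> real) \<Rightarrow> ('n::finite \<Rightarrow> real ^ 'n \<Rightarrow> real) \<Rightarrow>
     ('n \<Rightarrow> real \<Rightarrow> real \<Rightarrow> real) \<Rightarrow> (real \<Rightarrow> real) set \<Rightarrow> real \<Rightarrow> nat \<Rightarrow>
     ('n \<Rightarrow> real \<Rightarrow> real) \<Rightarrow> ('n \<Rightarrow> real \<Rightarrow> real) \<Rightarrow> bool" where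
  "euler_step T \<alpha> \<beta> a f S \<delta> n Vn V \<longleftrightarrow>
     (\<forall>i. V i \<in> S) \<and>
     (let t = real (Suc n) * \<delta> in
       \<forall>i. \<forall>W\<in>S.
         L2_inner (\<lambda>y. (V i y - Vn i y) / \<delta>) W
         + coeff_b2 \<alpha> \<beta> t * a i (\<chi> j. nonlocal_l \<alpha> \<beta> t (V j)) * L2_inner (deriv (V i)) (deriv W)
         - L2_inner (\<lambda>y. coeff_b1 T \<alpha> \<beta> y t * deriv (V i) y) W
         = L2_inner (\<lambda>y. source_g \<alpha> \<beta> (f i) y t) W)"

end

theory Submission
  imports Defs
begin

text \<open>Two solutions \<open>X\<close>, \<open>Y\<close> of one step are compared by testing the difference of their equations
  with \<open>X - Y\<close>. The nonlocal coefficient contributes \<open>(a(l(X)) - a(l(Y))) (Y', (X - Y)')\<close>, which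
  Young's inequality absorbs for small \<open>\<delta>\<close>, provided that the norm of \<open>Y'\<close> is bounded independently
  of the mesh and of \<open>\<delta>\<close>. Such a bound follows from testing each step with the increment of
  the solution, a discrete Gronwall argument, and the stability of one-dimensional Lagrange
  interpolation in the energy norm.\<close>

section \<open>Meshes and piecewise polynomials\<close>

text \<open>Testing with the solution itself would control the energies only after summation over
  the time levels with weight \<open>\<delta>\<close>. A single level could then carry an energy of
  order \<open>1 / \<delta>\<close>, and the product of \<open>\<delta>\<close> with that energy,
  which has to be small in the comparison of \<open>X\<close> and \<open>Y\<close>, would merely be
  bounded. Testing with the increment controls the energy at each level. The price is that the
  diffusion coefficient, which depends on the unknown, multiplies a difference of energies without
  sign; since it is bounded below, it can be divided out step by step, and its variation in time
  never has to be estimated. The energy bound has to hold for an arbitrary chain of solutions,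
  because it is applied to the given levels extended by the competitor \<open>Y\<close>. It also
  needs initial energies bounded uniformly in the mesh, although the initial data are only limits of
  test functions; this is why increments of such functions are studied. The components are coupled
  through the nonlocal terms, so that only the sum of their squared distances can be shown to
  vanish.\<close>

lemma mesh_mono:
  assumes "mesh M x" "i \<le> j" "j \<le> M"
  shows "x i \<le> x j"
  using assms(2,3)
proof (induction j rule: dec_induct)
  case (step n)
  have "x n < x (Suc n)" using step.prems assms(1) by (auto simp: mesh_def)
  then show ?case using step by linarith
qed simp

lemma mesh_mem:
  assumes "mesh M x" "j \<le> M"
  shows "x j \<in> {0..1}"
  using mesh_mono[OF assms(1), of 0 j] mesh_mono[OF assms(1), of j M] assms
  by (auto simp: mesh_def)

lemma mesh_cover:
  assumes "mesh M x" "y \<in> {0..<1}"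
  shows "\<exists>j<M. x j \<le> y \<and> y < x (Suc j)"
proof -
  define j where "j = (LEAST j. y < x j)"
  have M: "y < x M" using assms by (auto simp: mesh_def)
  then have j: "y < x j" unfolding j_def by (rule LeastI)
  have "j \<le> M" unfolding j_def using M by (rule Least_le)
  have "j \<noteq> 0" using j assms by (auto simp: mesh_def intro: ccontr)
  then obtain i where i: "j = Suc i" by (cases j) auto
  have "\<not> y < x i" using not_less_Least[of i "\<lambda>j. y < x j"] i j_def by auto
  then show ?thesis using i j \<open>j \<le> M\<close> by (intro exI[of _ i]) auto
qed

lemma mesh_elements_disjoint:
  assumes "mesh M x"
  shows "disjoint_family_on (\<lambda>j. {x j<..<x (Suc j)}) {..<M}"
proof -
  have "{x i<..<x (Suc i)} \<inter> {x j<..<x (Suc j)} = {}" if "i < j" "j < M" for i j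
    using mesh_mono[OF assms, of "Suc i" j] that by auto
  then show ?thesis
    unfolding disjoint_family_on_def by (metis Int_commute lessThan_iff linorder_neqE_nat)
qed

text \<open>Both one-sided differences are collected in one union because this is the form in which
  integrals may ignore a countable set. It is what allows integrals over the unit interval to be
  split into integrals over open elements.\<close>

lemma mesh_elements_diff:
  assumes "mesh M x"
  shows "({0<..<1} - (\<Union>j\<in>{..<M}. {x j<..<x (Suc j)})) \<union>
         ((\<Union>j\<in>{..<M}. {x j<..<x (Suc j)}) - {0<..<1}) \<subseteq> x ` {..M}"
proof -
  have "(\<Union>j\<in>{..<M}. {x j<..<x (Suc j)}) \<subseteq> {0<..<1}"
  proof
    fix y assume "y \<in> (\<Union>j\<in>{..<M}. {x j<..<x (Suc j)})"
    then obtain j where "j < M" "x j < y" "y < x (Suc j)" by auto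
    then show "y \<in> {0<..<1}"
      using mesh_mem[OF assms, of j] mesh_mem[OF assms, of "Suc j"] by auto
  qed
  moreover have "y \<in> x ` {..M}" if "y \<in> {0<..<1}" "y \<notin> (\<Union>j\<in>{..<M}. {x j<..<x (Suc j)})" for y
    using mesh_cover[OF assms, of y] that by force
  ultimately show ?thesis by blast
qed

lemma mesh_set_integrable_iff:
  fixes f :: "real \<Rightarrow> real"
  assumes "mesh M x"
  shows "set_integrable lebesgue {0<..<1} f \<longleftrightarrow>
    (\<forall>j<M. set_integrable lebesgue {x j<..<x (Suc j)} f)"
proof -
  have eq: "set_integrable lebesgue {0<..<1} f \<longleftrightarrow>
    set_integrable lebesgue (\<Union>j\<in>{..<M}. {x j<..<x (Suc j)}) f"
    by (rule set_integrable_discrete_difference[OF _ mesh_elements_diff[OF assms]])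
      (auto simp: countable_finite)
  show ?thesis unfolding eq
    by (auto intro!: set_integrable_UN elim: set_integrable_subset)
qed

lemma mesh_set_integral_sum:
  fixes f :: "real \<Rightarrow> real"
  assumes "mesh M x" "set_integrable lebesgue {0<..<1} f"
  shows "(LINT y:{0<..<1}|lebesgue. f y) = (\<Sum>j<M. LINT y:{x j<..<x (Suc j)}|lebesgue. f y)"
proof -
  have "(LINT y:{0<..<1}|lebesgue. f y) = (LINT y:(\<Union>j\<in>{..<M}. {x j<..<x (Suc j)})|lebesgue. f y)"
    by (rule set_integral_discrete_difference[OF _ mesh_elements_diff[OF assms(1)]])
      (auto simp: countable_finite)
  also have "\<dots> = (\<Sum>j<M. LINT y:{x j<..<x (Suc j)}|lebesgue. f y)"
    using assms mesh_set_integrable_iff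
    by (intro set_integral_finite_Union mesh_elements_disjoint) auto
  finally show ?thesis .
qed

text \<open>Open elements and no bound on the degree: the class is then closed under products and
  contains elementwise derivatives, whose values at the mesh points are arbitrary.\<close>

definition piecewise_poly :: "nat \<Rightarrow> (nat \<Rightarrow> real) \<Rightarrow> (real \<Rightarrow> real) \<Rightarrow> bool" where
  "piecewise_poly M x f \<longleftrightarrow> (\<forall>j<M. \<exists>p. \<forall>y\<in>{x j<..<x (Suc j)}. f y = poly p y)"

lemma set_integrable_continuous_Ioo:
  fixes f :: "real \<Rightarrow> real"
  assumes "continuous_on {a..b} f"
  shows "set_integrable lebesgue {a<..<b} f"
  by (rule set_integrable_subset[OF absolutely_integrable_continuous_real[OF assms]]) auto

text \<open>On each open element the function agrees with a polynomial, which is continuous on the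
  closed element. This settles the integrability of all integrands in the energy estimates except
  those that contain the source term.\<close>

lemma piecewise_poly_integrable:
  assumes "mesh M x" "piecewise_poly M x f"
  shows "set_integrable lebesgue {0<..<1} f"
  unfolding mesh_set_integrable_iff[OF assms(1)]
proof (intro allI impI)
  fix j assume "j < M"
  then obtain p where p: "\<forall>y\<in>{x j<..<x (Suc j)}. f y = poly p y"
    using assms(2) by (auto simp: piecewise_poly_def)
  have "set_integrable lebesgue {x j<..<x (Suc j)} (poly p)"
    by (intro set_integrable_continuous_Ioo continuous_intros)
  then show "set_integrable lebesgue {x j<..<x (Suc j)} f"
    using p by (subst set_integrable_cong[where f' = "poly p"]) auto
qed

lemma piecewise_poly_const: "piecewise_poly M x (\<lambda>y. c)"
  unfolding piecewise_poly_def by (intro allI impI exI[of _ "[:c:]"]) auto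

lemma piecewise_poly_ident: "piecewise_poly M x (\<lambda>y. y)"
  unfolding piecewise_poly_def by (intro allI impI exI[of _ "[:0,1:]"]) auto

lemma piecewise_poly_add:
  assumes "piecewise_poly M x f" "piecewise_poly M x g"
  shows "piecewise_poly M x (\<lambda>y. f y + g y)"
  using assms unfolding piecewise_poly_def by (metis poly_add)

lemma piecewise_poly_diff:
  assumes "piecewise_poly M x f" "piecewise_poly M x g"
  shows "piecewise_poly M x (\<lambda>y. f y - g y)"
  using assms unfolding piecewise_poly_def by (metis poly_diff)

lemma piecewise_poly_mult:
  assumes "piecewise_poly M x f" "piecewise_poly M x g"
  shows "piecewise_poly M x (\<lambda>y. f y * g y)"
  using assms unfolding piecewise_poly_def by (metis poly_mult)

lemma piecewise_poly_divide:
  assumes "piecewise_poly M x f"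
  shows "piecewise_poly M x (\<lambda>y. f y / c)"
  using piecewise_poly_mult[OF assms piecewise_poly_const[of M x "1 / c"]] by simp

lemma piecewise_poly_power:
  assumes "piecewise_poly M x f"
  shows "piecewise_poly M x (\<lambda>y. f y ^ m)"
  by (induction m) (auto intro: piecewise_poly_mult piecewise_poly_const assms)

text \<open>At a fixed time the coefficient is affine in \<open>y\<close>.\<close>

lemma piecewise_poly_coeff_b1: "piecewise_poly M x (\<lambda>y. coeff_b1 T \<alpha> \<beta> y t)"
  unfolding coeff_b1_def
  by (intro piecewise_poly_divide piecewise_poly_add piecewise_poly_mult
      piecewise_poly_const piecewise_poly_ident)

lemmas piecewise_poly_intros = piecewise_poly_add piecewise_poly_diff piecewise_poly_mult
  piecewise_poly_divide piecewise_poly_power piecewise_poly_coeff_b1 piecewise_poly_const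

lemma deriv_piecewise:
  assumes "\<forall>y\<in>{a..b}. V y = poly p y" "y \<in> {a<..<b}"
  shows "(V has_real_derivative poly (pderiv p) y) (at y)"
proof -
  have "(poly p has_real_derivative poly (pderiv p) y) (at y)"
    by (rule poly_DERIV)
  then show ?thesis
    by (rule has_field_derivative_transform_within_open[where S = "{a<..<b}"]) (use assms in auto)
qed

lemma fe_space_piecewise_poly:
  assumes "V \<in> fe_space k M x"
  shows "piecewise_poly M x V"
  using assms unfolding fe_space_def piecewise_poly_def by fastforce

lemma fe_space_differentiable:
  assumes "V \<in> fe_space k M x" "j < M" "y \<in> {x j<..<x (Suc j)}"
  shows "V differentiable (at y)"
  using assms deriv_piecewise real_differentiable_def unfolding fe_space_def by blast

lemma fe_space_deriv_piecewise_poly: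
  assumes "V \<in> fe_space k M x"
  shows "piecewise_poly M x (deriv V)"
  unfolding piecewise_poly_def
proof (intro allI impI)
  fix j assume "j < M"
  then obtain p where "\<forall>y\<in>{x j..x (Suc j)}. V y = poly p y"
    using assms by (auto simp: fe_space_def)
  then show "\<exists>p. \<forall>y\<in>{x j<..<x (Suc j)}. deriv V y = poly p y"
    by (intro exI[of _ "pderiv p"]) (blast intro: DERIV_imp_deriv deriv_piecewise)
qed

lemma fe_space_diff:
  assumes "V \<in> fe_space k M x" "U \<in> fe_space k M x"
  shows "(\<lambda>y. V y - U y) \<in> fe_space k M x"
proof -
  have "\<exists>p::real poly. degree p \<le> k \<and> (\<forall>y\<in>{x j..x (Suc j)}. V y - U y = poly p y)" if "j < M" for j
  proof -
    from that assms obtain p q :: "real poly" where "degree p \<le> k" "degree q \<le> k"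
      "\<forall>y\<in>{x j..x (Suc j)}. V y = poly p y" "\<forall>y\<in>{x j..x (Suc j)}. U y = poly q y"
      unfolding fe_space_def by blast
    then show ?thesis
      by (intro exI[of _ "p - q"]) (auto intro: degree_diff_le)
  qed
  then show ?thesis
    using assms by (auto simp: fe_space_def intro: continuous_on_diff)
qed

text \<open>Restricted to the interior of an element, where both functions are polynomials. At a
  mesh point the kinks of \<open>V\<close> and \<open>U\<close> may cancel in the difference, while
  \<open>deriv V\<close> and \<open>deriv U\<close> have no meaning there.\<close>

lemma fe_space_deriv_diff:
  assumes "V \<in> fe_space k M x" "U \<in> fe_space k M x" "j < M" "y \<in> {x j<..<x (Suc j)}"
  shows "deriv (\<lambda>y. V y - U y) y = deriv V y - deriv U y"
  using fe_space_differentiable[OF assms(1,3,4)] fe_space_differentiable[OF assms(2-4)]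
  by (intro deriv_diff) (auto simp: field_differentiable_def real_differentiable_def)

text \<open>Mesh points do not enter the integrals, so identities for \<open>deriv\<close> that hold
  inside the elements carry over to inner products.\<close>

lemma piecewise_poly_integral_cong:
  assumes "mesh M x" "piecewise_poly M x f" "piecewise_poly M x g"
    and "\<And>j y. j < M \<Longrightarrow> y \<in> {x j<..<x (Suc j)} \<Longrightarrow> f y = g y"
  shows "(LINT y:{0<..<1}|lebesgue. f y) = (LINT y:{0<..<1}|lebesgue. g y)"
  using assms
  by (auto simp: mesh_set_integral_sum piecewise_poly_integrable intro!: sum.cong set_lebesgue_integral_cong)

section \<open>Increments of functions in the energy space\<close>

lemma L2_on_mult_integrable:
  assumes "L2_on S f" "L2_on S g"
  shows "set_integrable lebesgue S (\<lambda>x. f x * g x)"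
proof (rule set_integrable_bound[where f = "\<lambda>x. (f x)\<^sup>2 + (g x)\<^sup>2"])
  show "set_integrable lebesgue S (\<lambda>x. (f x)\<^sup>2 + (g x)\<^sup>2)"
    using assms by (auto simp: L2_on_def)
  \<comment> \<open>The indicator is idempotent, so the product of the two cut-off functions is the
    cut-off product; only the cut-off functions are known to be measurable.\<close>
  have "(\<lambda>x. (indicator S x *\<^sub>R f x) * (indicator S x *\<^sub>R g x)) \<in> borel_measurable lebesgue"
    using assms unfolding L2_on_def set_borel_measurable_def by (intro borel_measurable_times) auto
  then show "set_borel_measurable lebesgue S (\<lambda>x. f x * g x)"
    unfolding set_borel_measurable_def
    by (rule measurable_cong[THEN iffD1, rotated]) (auto simp: indicator_def)
  have "\<bar>f x * g x\<bar> \<le> (f x)\<^sup>2 + (g x)\<^sup>2" for x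
    using sum_squares_bound[of "f x" "g x"] sum_squares_bound[of "f x" "- g x"]
    using zero_le_power2[of "f x"] zero_le_power2[of "g x"] unfolding abs_le_iff by simp
  then show "AE x in lebesgue. x \<in> S \<longrightarrow> norm (f x * g x) \<le> norm ((f x)\<^sup>2 + (g x)\<^sup>2)"
    by simp
qed

lemma L2_on_const:
  assumes "S \<in> lmeasurable"
  shows "L2_on S (\<lambda>x. c)"
proof -
  have "set_integrable lebesgue S (\<lambda>x. d::real)" for d
    using assms unfolding set_integrable_def by (auto simp: fmeasurable_def)
  moreover have "set_borel_measurable lebesgue S (\<lambda>x. c)"
    using assms unfolding set_borel_measurable_def
    by (intro borel_measurable_scaleR borel_measurable_indicator) auto
  ultimately show ?thesis by (simp add: L2_on_def)
qed

lemma L2_on_integrable: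
  assumes "L2_on S f" "S \<in> lmeasurable"
  shows "set_integrable lebesgue S f"
  using L2_on_mult_integrable[OF assms(1) L2_on_const[OF assms(2), of 1]] by simp

lemma L2_on_subset:
  assumes "L2_on S f" "R \<subseteq> S" "R \<in> sets lebesgue"
  shows "L2_on R f"
  using assms(1) unfolding L2_on_def
  by (intro conjI set_integrable_subset[OF _ assms(3,2)] set_borel_measurable_subset[OF _ assms(3,2)]) auto

lemma L2_on_diff:
  assumes "L2_on S f" "L2_on S g"
  shows "L2_on S (\<lambda>x. f x - g x)"
proof -
  have "set_integrable lebesgue S (\<lambda>x. (f x)\<^sup>2 - 2 * (f x * g x) + (g x)\<^sup>2)"
    using assms L2_on_mult_integrable[OF assms]
    by (intro set_integral_add(1) set_integral_diff(1) set_integrable_mult_right) (simp_all add: L2_on_def)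
  moreover have "(\<lambda>x. (f x - g x)\<^sup>2) = (\<lambda>x. (f x)\<^sup>2 - 2 * (f x * g x) + (g x)\<^sup>2)"
    by (auto simp: power2_diff algebra_simps)
  ultimately show ?thesis
    using assms unfolding L2_on_def set_borel_measurable_def scaleR_diff_right
    by (intro conjI borel_measurable_diff) simp_all
qed

lemma L2_on_continuous_Ioo:
  fixes f :: "real \<Rightarrow> real"
  assumes "continuous_on {a..b} f"
  shows "L2_on {a<..<b} f"
proof -
  have "set_integrable lebesgue {a<..<b} f" "set_integrable lebesgue {a<..<b} (\<lambda>x. (f x)\<^sup>2)"
    using assms by (auto intro!: set_integrable_continuous_Ioo continuous_intros)
  then show ?thesis
    by (auto simp: L2_on_def set_integrable_def set_borel_measurable_def)
qed

lemma set_integral_nonneg_real: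
  assumes "\<And>x. x \<in> S \<Longrightarrow> (0::real) \<le> f x"
  shows "0 \<le> (LINT x:S|M. f x)"
  unfolding set_lebesgue_integral_def using assms
  by (intro integral_nonneg_AE) (auto simp: indicator_def)

lemma set_integral_const_Ioo:
  assumes "a \<le> b"
  shows "(LINT s:{a<..<b}|lebesgue. (c::real)) = (b - a) * c"
  using assms by (subst set_integral_const) auto

text \<open>Cauchy-Schwarz against the constant 1, derived from the nonnegativity of the variance:
  \<open>c\<close> is the mean of \<open>f\<close> over the interval.\<close>

lemma integral_Ioo_square_le:
  fixes f :: "real \<Rightarrow> real"
  assumes "a \<le> b" "L2_on {a<..<b} f"
  shows "(LINT s:{a<..<b}|lebesgue. f s)\<^sup>2 \<le> (b - a) * (LINT s:{a<..<b}|lebesgue. (f s)\<^sup>2)"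
proof (cases "a = b")
  case True
  then show ?thesis by (simp add: set_lebesgue_integral_def)
next
  case False
  then have ab: "a < b" using assms by simp
  define I where "I = (LINT s:{a<..<b}|lebesgue. f s)"
  define c where "c = I / (b - a)"
  have i1: "set_integrable lebesgue {a<..<b} f" "set_integrable lebesgue {a<..<b} (\<lambda>s. (f s)\<^sup>2)"
    using assms L2_on_integrable by (auto simp: L2_on_def)
  have i3: "set_integrable lebesgue {a<..<b} (\<lambda>s. c\<^sup>2)"
    by (intro set_integrable_continuous_Ioo continuous_intros)
  have "0 \<le> (LINT s:{a<..<b}|lebesgue. (f s - c)\<^sup>2)"
    by (rule set_integral_nonneg_real) auto
  also have "(\<lambda>s. (f s - c)\<^sup>2) = (\<lambda>s. (f s)\<^sup>2 - 2 * c * f s + c\<^sup>2)"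
    by (auto simp: power2_diff algebra_simps)
  also have "(LINT s:{a<..<b}|lebesgue. (f s)\<^sup>2 - 2 * c * f s + c\<^sup>2) =
      (LINT s:{a<..<b}|lebesgue. (f s)\<^sup>2) - 2 * c * I + (b - a) * c\<^sup>2"
    using ab i1 i3 by (simp add: I_def set_integral_const_Ioo)
  finally have "0 \<le> (b - a) * ((LINT s:{a<..<b}|lebesgue. (f s)\<^sup>2) - 2 * c * I + (b - a) * c\<^sup>2)"
    using ab by simp
  also have "\<dots> = (b - a) * (LINT s:{a<..<b}|lebesgue. (f s)\<^sup>2) - I\<^sup>2"
  proof -
    have I: "I = c * (b - a)" using ab by (simp add: c_def)
    show ?thesis unfolding I by (simp add: algebra_simps power2_eq_square)
  qed
  finally show ?thesis by (simp add: I_def)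
qed

section \<open>Test functions and the primitive of the weak derivative\<close>

lemma test_function_differentiable:
  assumes "test_function a b \<phi>"
  shows "\<phi> differentiable (at s)"
proof -
  have "((deriv ^^ 0) \<phi>) differentiable (at s)"
    using assms unfolding test_function_def by blast
  then show ?thesis by simp
qed

lemma test_function_continuous_on_deriv:
  assumes "test_function a b \<phi>"
  shows "continuous_on S (deriv \<phi>)"
proof -
  have "\<forall>x. ((deriv ^^ 1) \<phi>) differentiable (at x)"
    using assms unfolding test_function_def by blast
  then show ?thesis
    by (intro continuous_at_imp_continuous_on ballI differentiable_imp_continuous_within) simp
qed

text \<open>The closure of the support avoids \<open>a\<close>, so the fundamental theorem leaves no
  constant.\<close>

lemma test_function_integral_deriv:
  assumes "test_function a b \<phi>" "a \<le> y"
  shows "(LINT s:{a<..<y}|lebesgue. deriv \<phi> s) = \<phi> y"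
proof -
  have "(\<phi> has_vector_derivative deriv \<phi> s) (at s within {a..y})" for s
    using test_function_differentiable[OF assms(1), of s]
    by (metis DERIV_deriv_iff_real_differentiable has_field_derivative_at_within
        has_real_derivative_iff_has_vector_derivative)
  then have "(deriv \<phi> has_integral (\<phi> y - \<phi> a)) {a..y}"
    by (intro fundamental_theorem_of_calculus assms) auto
  moreover have "\<phi> a = 0"
    using assms closure_subset[of "{x. \<phi> x \<noteq> 0}"] unfolding test_function_def by auto
  ultimately have "integral {a<..<y} (deriv \<phi>) = \<phi> y"
    using integral_open_interval_real[of a y "deriv \<phi>"] by (simp add: integral_unique)
  then show ?thesis
    using set_lebesgue_integral_eq_integral(2)[OF set_integrable_continuous_Ioo[OF
          test_function_continuous_on_deriv[OF assms(1)]]] by simp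
qed

lemma test_function_continuous_on:
  assumes "test_function a b \<phi>"
  shows "continuous_on S \<phi>"
proof -
  note test_function_differentiable[OF assms]
  then show ?thesis
    by (intro continuous_at_imp_continuous_on ballI differentiable_imp_continuous_within) simp
qed

text \<open>Turns a vanishing L2 distance into equality at every point, end points included. It
  serves twice: to identify a function with the primitive of its weak derivative, and to conclude
  that two discrete solutions coincide.\<close>

lemma continuous_square_integral_zero:
  fixes f :: "real \<Rightarrow> real"
  assumes "a < b" "continuous_on {a..b} f" "(LINT s:{a<..<b}|lebesgue. (f s)\<^sup>2) \<le> 0" "y \<in> {a..b}"
  shows "f y = 0"
proof -
  have c: "continuous_on {a..b} (\<lambda>s. (f s)\<^sup>2)"
    using assms by (intro continuous_intros)
  have "(LINT s:{a<..<b}|lebesgue. (f s)\<^sup>2) = integral {a..b} (\<lambda>s. (f s)\<^sup>2)"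
    using set_lebesgue_integral_eq_integral(2)[OF set_integrable_continuous_Ioo[OF c]]
      integral_open_interval_real[of a b "\<lambda>s. (f s)\<^sup>2"] by simp
  moreover have "0 \<le> (LINT s:{a<..<b}|lebesgue. (f s)\<^sup>2)"
    by (rule set_integral_nonneg_real) auto
  ultimately have "integral {a..b} (\<lambda>s. (f s)\<^sup>2) = 0"
    using assms by simp
  then show ?thesis
    using integral_eq_0_iff[OF c assms(1)] assms by auto
qed

lemma set_integral_Ioo_split:
  fixes f :: "real \<Rightarrow> real"
  assumes "a \<le> c" "c \<le> b" "set_integrable lebesgue {a<..<b} f"
  shows "(LINT s:{a<..<b}|lebesgue. f s) =
    (LINT s:{a<..<c}|lebesgue. f s) + (LINT s:{c<..<b}|lebesgue. f s)"
proof -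
  have i: "set_integrable lebesgue {a<..<c} f" "set_integrable lebesgue {c<..<b} f"
    by (rule set_integrable_subset[OF assms(3)]; use assms in auto)+
  have "(LINT s:{a<..<b}|lebesgue. f s) = (LINT s:{a<..<c} \<union> {c<..<b}|lebesgue. f s)"
    by (rule set_integral_discrete_difference[where X = "{c}"]) (use assms in auto)
  also have "\<dots> = (LINT s:{a<..<c}|lebesgue. f s) + (LINT s:{c<..<b}|lebesgue. f s)"
    using i by (intro set_integral_Un) auto
  finally show ?thesis .
qed

text \<open>The representative \<open>u\<close> is the primitive of its weak derivative
  \<open>w\<close>, and the estimate is Cauchy-Schwarz on \<open>]x,y[\<close>. The integral on the
  right runs over \<open>]x,y[\<close> only, so that estimates on disjoint elements add up to the
  energy on the whole interval.\<close>

lemma H10_increment: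
  assumes "u \<in> H10 a b" "a < b"
  obtains w where "L2_on {a<..<b} w"
    "\<And>x y. a \<le> x \<Longrightarrow> x \<le> y \<Longrightarrow> y \<le> b \<Longrightarrow>
      (u y - u x)\<^sup>2 \<le> (y - x) * (LINT s:{x<..<y}|lebesgue. (w s)\<^sup>2)"
proof -
  from assms obtain w \<phi> where u: "continuous_on {a..b} u" and w: "L2_on {a<..<b} w"
    and \<phi>: "\<And>m::nat. test_function a b (\<phi> m)"
    and lim: "(\<lambda>m. LINT x:{a<..<b}|lebesgue. (\<phi> m x - u x)\<^sup>2) \<longlonglongrightarrow> 0"
    and lim': "(\<lambda>m. LINT x:{a<..<b}|lebesgue. (deriv (\<phi> m) x - w x)\<^sup>2) \<longlonglongrightarrow> 0"
    unfolding H10_def by blast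
  define D where "D m = (LINT x:{a<..<b}|lebesgue. (deriv (\<phi> m) x - w x)\<^sup>2)" for m
  \<comment> \<open>The candidate for \<open>u\<close>: the primitive of \<open>w\<close> that
    vanishes at \<open>a\<close>, just as \<open>\<phi> m\<close> is the primitive of its own
    derivative.\<close>
  define W where "W y = (LINT s:{a<..<y}|lebesgue. w s)" for y
  have L2sub: "L2_on {x<..<y} w" if "a \<le> x" "y \<le> b" for x y
    by (rule L2_on_subset[OF w]) (use that in auto)
  have w_int: "set_integrable lebesgue {a<..<b} w"
    by (rule L2_on_integrable[OF w]) auto
  have W_cont: "continuous_on {a..b} W"
  proof -
    have "w integrable_on {a..b}"
      using set_lebesgue_integral_eq_integral(1)[OF w_int]
      by (meson has_integral_Icc_iff_Ioo integrable_on_def)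
    then have "continuous_on {a..b} (\<lambda>y. integral {a..y} w)"
      by (rule indefinite_integral_continuous_1)
    moreover have "integral {a..y} w = W y" if "y \<in> {a..b}" for y
      unfolding W_def integral_open_interval_real
      by (rule set_lebesgue_integral_eq_integral(2)[symmetric], rule L2_on_integrable[OF L2sub])
        (use that in auto)
    ultimately show ?thesis by (subst continuous_on_cong[OF refl, symmetric]) auto
  qed
  have L2d: "L2_on {x<..<y} (\<lambda>s. deriv (\<phi> m) s - w s)" if "a \<le> x" "y \<le> b" for x y m
    by (intro L2_on_diff L2_on_continuous_Ioo test_function_continuous_on_deriv[OF \<phi>] L2sub that)
  \<comment> \<open>L2 convergence of the derivatives makes the primitives converge uniformly, with
    a rate independent of \<open>y\<close>.\<close>
  have close: "(\<phi> m y - W y)\<^sup>2 \<le> (b - a) * D m" if y: "y \<in> {a..b}" for m y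
  proof -
    have "\<phi> m y - W y = (LINT s:{a<..<y}|lebesgue. deriv (\<phi> m) s - w s)"
    proof (subst set_integral_diff)
      show "set_integrable lebesgue {a<..<y} (deriv (\<phi> m))"
        by (intro set_integrable_continuous_Ioo test_function_continuous_on_deriv[OF \<phi>])
      show "set_integrable lebesgue {a<..<y} w"
        by (rule L2_on_integrable[OF L2sub]) (use y in auto)
    qed (use y in \<open>simp add: W_def test_function_integral_deriv[OF \<phi>]\<close>)
    then have "(\<phi> m y - W y)\<^sup>2 \<le> (y - a) * (LINT s:{a<..<y}|lebesgue. (deriv (\<phi> m) s - w s)\<^sup>2)"
      using integral_Ioo_square_le[OF _ L2d[of a y m]] y by auto
    also have "\<dots> \<le> (b - a) * D m"
    proof (rule mult_mono)
      have "D m = (LINT s:{a<..<y}|lebesgue. (deriv (\<phi> m) s - w s)\<^sup>2) +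
          (LINT s:{y<..<b}|lebesgue. (deriv (\<phi> m) s - w s)\<^sup>2)"
        unfolding D_def using y L2d[of a b m]
        by (intro set_integral_Ioo_split) (auto simp: L2_on_def)
      moreover have "0 \<le> (LINT s:{y<..<b}|lebesgue. (deriv (\<phi> m) s - w s)\<^sup>2)"
        by (rule set_integral_nonneg_real) auto
      ultimately show "(LINT s:{a<..<y}|lebesgue. (deriv (\<phi> m) s - w s)\<^sup>2) \<le> D m" by simp
    qed (use y assms in \<open>auto intro: set_integral_nonneg_real\<close>)
    finally show ?thesis .
  qed
  \<comment> \<open>Both \<open>u\<close> and \<open>W\<close> are L2 limits of the same sequence
    \<open>\<phi>\<close>; letting \<open>m\<close> tend to infinity gives distance zero.\<close>
  have "(LINT s:{a<..<b}|lebesgue. (u s - W s)\<^sup>2) \<le>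
      2 * (LINT x:{a<..<b}|lebesgue. (\<phi> m x - u x)\<^sup>2) + (b - a) * (2 * ((b - a) * D m))" for m
  proof -
    have "(LINT s:{a<..<b}|lebesgue. (u s - W s)\<^sup>2) \<le>
       (LINT s:{a<..<b}|lebesgue. 2 * (\<phi> m s - u s)\<^sup>2 + 2 * ((b - a) * D m))"
    proof (rule set_integral_mono)
      fix s assume s: "s \<in> {a<..<b}"
      have "(u s - W s)\<^sup>2 \<le> 2 * (\<phi> m s - u s)\<^sup>2 + 2 * (\<phi> m s - W s)\<^sup>2"
        using zero_le_power2[of "(\<phi> m s - u s) + (\<phi> m s - W s)"]
        by (simp add: power2_eq_square algebra_simps)
      then show "(u s - W s)\<^sup>2 \<le> 2 * (\<phi> m s - u s)\<^sup>2 + 2 * ((b - a) * D m)"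
        using close[of s m] s by auto
    qed (intro set_integrable_continuous_Ioo continuous_intros u W_cont test_function_continuous_on[OF \<phi>])+
    also have "\<dots> = 2 * (LINT x:{a<..<b}|lebesgue. (\<phi> m x - u x)\<^sup>2) + (b - a) * (2 * ((b - a) * D m))"
      using assms
      by (subst set_integral_add) (auto simp: set_integral_const_Ioo intro!: set_integrable_continuous_Ioo
        continuous_intros u test_function_continuous_on[OF \<phi>])
    finally show ?thesis .
  qed
  moreover have "(\<lambda>m. 2 * (LINT x:{a<..<b}|lebesgue. (\<phi> m x - u x)\<^sup>2) + (b - a) * (2 * ((b - a) * D m)))
      \<longlonglongrightarrow> 2 * 0 + (b - a) * (2 * ((b - a) * 0))"
    unfolding D_def by (intro tendsto_intros lim lim')
  ultimately have "(LINT s:{a<..<b}|lebesgue. (u s - W s)\<^sup>2) \<le> 0"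
    by (intro LIMSEQ_le_const[of _ 0]) auto
  then have uW: "u y = W y" if "y \<in> {a..b}" for y
    using continuous_square_integral_zero[of a b "\<lambda>s. u s - W s" y] assms u W_cont that
    by (auto intro: continuous_intros)
  show ?thesis
  proof (rule that[OF w])
    fix x y assume xy: "a \<le> x" "x \<le> y" "y \<le> b"
    then have "u y - u x = (LINT s:{x<..<y}|lebesgue. w s)"
      using uW[of x] uW[of y] set_integral_Ioo_split[of a x y w] L2_on_integrable[OF L2sub[of a y]]
      by (auto simp: W_def)
    then show "(u y - u x)\<^sup>2 \<le> (y - x) * (LINT s:{x<..<y}|lebesgue. (w s)\<^sup>2)"
      using integral_Ioo_square_le[OF xy(2) L2sub] xy by simp
  qed
qed

section \<open>Stability of Lagrange interpolation\<close>

text \<open>Expanding \<open>p\<close> minus its value at \<open>\<xi> 0\<close> in the Lagrange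
  basis \<open>l\<close> and differentiating gives a sum of nodal differences times
  \<open>pderiv (l r)\<close>, which is bounded on \<open>[0,1]\<close> by compactness. Subtracting
  the constant first is what produces differences rather than nodal values, as is needed for an
  estimate by the energy alone. The constant depends on the nodes only.\<close>

lemma poly_deriv_bound_by_nodes:
  fixes \<xi> :: "nat \<Rightarrow> real"
  assumes inj: "inj_on \<xi> {..k}"
  obtains C where "0 \<le> C"
    "\<And>p y. degree p \<le> k \<Longrightarrow> y \<in> {0..1} \<Longrightarrow>
      \<bar>poly (pderiv p) y\<bar> \<le> C * (\<Sum>r\<le>k. \<bar>poly p (\<xi> r) - poly p (\<xi> 0)\<bar>)"
proof -
  define l where "l r = (\<Prod>s\<in>{..k}-{r}. smult (1 / (\<xi> r - \<xi> s)) [:- \<xi> s, 1:])" for r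
  have deg_l: "degree (l r) \<le> k" if "r \<le> k" for r
  proof -
    have "degree (l r) \<le> (\<Sum>s\<in>{..k}-{r}. degree (smult (1 / (\<xi> r - \<xi> s)) [:- \<xi> s, 1:]))"
      unfolding l_def by (rule order.trans[OF degree_prod_sum_le]) (auto simp: o_def)
    also have "\<dots> \<le> (\<Sum>s\<in>{..k}-{r}. 1)"
      by (intro sum_mono order.trans[OF degree_smult_le]) simp
    also have "\<dots> = k" using that by simp
    finally show ?thesis .
  qed
  have l_node: "poly (l r) (\<xi> s) = (if r = s then 1 else 0)" if "r \<le> k" "s \<le> k" for r s
  proof (cases "r = s")
    case True
    have "\<xi> r \<noteq> \<xi> q" if "q \<in> {..k}-{r}" for q
      using inj that \<open>r \<le> k\<close> by (auto dest: inj_onD)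
    then show ?thesis
      using True by (auto simp: l_def poly_prod diff_divide_distrib[symmetric] intro!: prod.neutral)
  next
    case False
    then have "\<exists>q\<in>{..k}-{r}. poly (smult (1 / (\<xi> r - \<xi> q)) [:- \<xi> q, 1:]) (\<xi> s) = 0"
      using that by (intro bexI[of _ s]) auto
    then show ?thesis
      using False unfolding l_def poly_prod by (subst prod_zero) auto
  qed
  have "\<exists>B. \<forall>y\<in>{0..1}. \<bar>poly (pderiv (l r)) y\<bar> \<le> B" for r
  proof -
    have "bounded (poly (pderiv (l r)) ` {0..1})"
      by (intro compact_imp_bounded compact_continuous_image continuous_intros) auto
    then show ?thesis by (auto simp: bounded_iff)
  qed
  then obtain B where B: "\<And>r y. y \<in> {0..1} \<Longrightarrow> \<bar>poly (pderiv (l r)) y\<bar> \<le> B r"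
    by metis
  have B0: "0 \<le> B r" for r
    using B[of 0 r] by simp
  show ?thesis
  proof (rule that[of "sum B {..k}"])
    fix p :: "real poly" and y :: real assume p: "degree p \<le> k" and y: "y \<in> {0..1}"
    define d where "d r = poly p (\<xi> r) - poly p (\<xi> 0)" for r
    have eq: "p - [:poly p (\<xi> 0):] = (\<Sum>r\<le>k. smult (d r) (l r))"
    proof (rule poly_eqI_degree[where A = "\<xi> ` {..k}"])
      fix z assume "z \<in> \<xi> ` {..k}"
      then obtain s where s: "s \<le> k" "z = \<xi> s" by auto
      have "poly (\<Sum>r\<le>k. smult (d r) (l r)) z = (\<Sum>r\<le>k. if r = s then d r else 0)"
        unfolding poly_sum s(2) by (intro sum.cong) (auto simp: l_node s(1))
      then show "poly (p - [:poly p (\<xi> 0):]) z = poly (\<Sum>r\<le>k. smult (d r) (l r)) z"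
        using s by (simp add: d_def)
    next
      have "degree (p - [:poly p (\<xi> 0):]) \<le> k"
        using p by (intro degree_diff_le) auto
      then show "degree (p - [:poly p (\<xi> 0):]) < card (\<xi> ` {..k})"
        by (simp add: card_image[OF inj])
      have "degree (\<Sum>r\<le>k. smult (d r) (l r)) \<le> k"
        by (intro degree_sum_le order.trans[OF degree_smult_le] deg_l) auto
      then show "degree (\<Sum>r\<le>k. smult (d r) (l r)) < card (\<xi> ` {..k})"
        by (simp add: card_image[OF inj])
    qed
    have "pderiv p = pderiv (p - [:poly p (\<xi> 0):])"
      by (simp add: pderiv_diff pderiv_pCons)
    then have "pderiv p = (\<Sum>r\<le>k. smult (d r) (pderiv (l r)))"
      unfolding eq by (simp add: higher_pderiv_sum[of 1, simplified] pderiv_smult)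
    then have "\<bar>poly (pderiv p) y\<bar> \<le> (\<Sum>r\<le>k. \<bar>d r * poly (pderiv (l r)) y\<bar>)"
      by (simp add: poly_sum)
    also have "\<dots> \<le> (\<Sum>r\<le>k. sum B {..k} * \<bar>d r\<bar>)"
    proof (rule sum_mono)
      fix r assume "r \<in> {..k}"
      then have "B r \<le> sum B {..k}" by (intro member_le_sum) (auto simp: B0)
      then show "\<bar>d r * poly (pderiv (l r)) y\<bar> \<le> sum B {..k} * \<bar>d r\<bar>"
        using order.trans[OF B[OF y, of r]] by (simp add: abs_mult mult.commute mult_left_mono)
    qed
    finally show "\<bar>poly (pderiv p) y\<bar> \<le> sum B {..k} * (\<Sum>r\<le>k. \<bar>poly p (\<xi> r) - poly p (\<xi> 0)\<bar>)"
      by (simp add: d_def sum_distrib_left)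
  qed (simp add: B0 sum_nonneg)
qed

section \<open>From the reference element to the elements of a mesh\<close>

lemma lagrange_nodes_less:
  assumes "lagrange_nodes k \<xi>" "i < j" "j \<le> k"
  shows "\<xi> i < \<xi> j"
  using assms(2,3)
proof (induction j)
  case (Suc j)
  have "\<xi> j < \<xi> (Suc j)" using Suc.prems assms(1) by (auto simp: lagrange_nodes_def)
  then show ?case using Suc by (cases "i = j") auto
qed simp

lemma lagrange_nodes_inj: "lagrange_nodes k \<xi> \<Longrightarrow> inj_on \<xi> {..k}"
  by (intro linorder_inj_onI') (force dest: lagrange_nodes_less)

lemma lagrange_nodes_mem:
  assumes "lagrange_nodes k \<xi>" "r \<le> k"
  shows "\<xi> r \<in> {0..1}"
  using lagrange_nodes_less[OF assms(1), of 0 r] lagrange_nodes_less[OF assms(1), of r k] assms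
  by (cases "r = 0"; cases "r = k") (auto simp: lagrange_nodes_def)

text \<open>Affine scaling to the reference element: with \<open>h = b - a\<close>, the chain rule
  puts a factor \<open>h\<close> on the derivative, whereas each squared nodal increment is at most
  \<open>h * E\<close>. One factor \<open>h\<close> cancels after squaring, and integration over an
  element of length \<open>h\<close> removes the remaining one, so no power of the mesh size
  survives.\<close>

lemma lagrange_element_deriv_bound:
  assumes nodes: "lagrange_nodes k \<xi>"
    and C: "0 \<le> C" "\<And>p y. degree p \<le> k \<Longrightarrow> y \<in> {0..1} \<Longrightarrow>
      \<bar>poly (pderiv p) y\<bar> \<le> C * (\<Sum>r\<le>k. \<bar>poly p (\<xi> r) - poly p (\<xi> 0)\<bar>)"
    and p: "degree p \<le> k" and "a < b"
    and E: "\<And>r. r \<le> k \<Longrightarrow> (poly p (a + \<xi> r * (b - a)) - poly p a)\<^sup>2 \<le> (b - a) * E"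
    and y: "y \<in> {a..b}"
  shows "(poly (pderiv p) y)\<^sup>2 \<le> (C * (real k + 1))\<^sup>2 * E / (b - a)"
proof -
  define h where "h = b - a"
  define q where "q = pcompose p [:a, h:]"
  have h: "0 < h" using assms by (simp add: h_def)
  have q: "poly q s = poly p (a + s * h)" for s
    by (simp add: q_def poly_pcompose)
  have q': "poly (pderiv q) s = h * poly (pderiv p) (a + s * h)" for s
    by (simp add: q_def pderiv_pcompose poly_pcompose pderiv_pCons)
  define s where "s = (y - a) / h"
  have s: "s \<in> {0..1}" "a + s * h = y" using h y by (auto simp: s_def h_def field_simps)
  have x0: "\<xi> 0 = 0" using nodes by (simp add: lagrange_nodes_def)
  have "0 \<le> h * E" using E[of 0] zero_le_power2 by (metis h_def le0 order.trans)
  have "degree q \<le> k"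
    using p order.trans[OF degree_pcompose_le[of p "[:a,h:]"]] by (simp add: q_def)
  then have "\<bar>h * poly (pderiv p) y\<bar> \<le> C * (\<Sum>r\<le>k. \<bar>poly q (\<xi> r) - poly q (\<xi> 0)\<bar>)"
    using C(2)[of q s] s by (simp add: q')
  also have "\<dots> \<le> C * (\<Sum>r\<le>k. sqrt (h * E))"
    using E by (intro mult_left_mono sum_mono C(1) real_le_rsqrt) (auto simp: q x0 h_def)
  finally have "\<bar>h * poly (pderiv p) y\<bar> \<le> C * (real k + 1) * sqrt (h * E)"
    by (simp add: algebra_simps)
  then have "(h * poly (pderiv p) y)\<^sup>2 \<le> (C * (real k + 1) * sqrt (h * E))\<^sup>2"
    using power_mono[of "\<bar>h * poly (pderiv p) y\<bar>" _ 2] by simp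
  then have "h * (h * (poly (pderiv p) y)\<^sup>2) \<le> h * ((C * (real k + 1))\<^sup>2 * E)"
    using \<open>0 \<le> h * E\<close> by (simp add: power_mult_distrib real_sqrt_pow2 power2_eq_square mult_ac)
  then show ?thesis
    using h by (simp add: h_def[symmetric] field_simps)
qed

text \<open>On each element the interpolant only sees increments of \<open>u\<close>, which are
  bounded by the energy of \<open>w\<close> on the image of that element. These local energies add
  up to the total energy of \<open>w\<close>, so \<open>K\<close> can be fixed before the
  mesh.\<close>

lemma lagrange_interpolant_energy:
  assumes nodes: "lagrange_nodes k \<xi>" and u: "u \<in> H10 (\<alpha> 0) (\<beta> 0)" and pos: "\<alpha> 0 < \<beta> 0"
  shows "\<exists>K\<ge>0. \<forall>M x V. mesh M x \<longrightarrow> lagrange_interpolant k \<xi> M x (init_v \<alpha> \<beta> u) V \<longrightarrow>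
    L2_inner (deriv V) (deriv V) \<le> K"
proof -
  obtain w where w: "L2_on {\<alpha> 0<..<\<beta> 0} w" and
    inc: "\<And>x y. \<alpha> 0 \<le> x \<Longrightarrow> x \<le> y \<Longrightarrow> y \<le> \<beta> 0 \<Longrightarrow>
      (u y - u x)\<^sup>2 \<le> (y - x) * (LINT s:{x<..<y}|lebesgue. (w s)\<^sup>2)"
    using H10_increment[OF u pos] by blast
  obtain C where C: "0 \<le> C" "\<And>p y. degree p \<le> k \<Longrightarrow> y \<in> {0..1} \<Longrightarrow>
      \<bar>poly (pderiv p) y\<bar> \<le> C * (\<Sum>r\<le>k. \<bar>poly p (\<xi> r) - poly p (\<xi> 0)\<bar>)"
    using poly_deriv_bound_by_nodes[OF lagrange_nodes_inj[OF nodes]] by blast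
  define \<gamma> where "\<gamma> = width \<alpha> \<beta> 0"
  define e where "e z = \<alpha> 0 + \<gamma> * z" for z
  \<comment> \<open>Energy of \<open>w\<close> on the image of \<open>]a,b[\<close> under the affine
    map \<open>e\<close> from the reference to the physical interval.\<close>
  define E where "E a b = (LINT s:{e a<..<e b}|lebesgue. (w s)\<^sup>2)" for a b
  \<comment> \<open>The constant of the element estimate times the factor \<open>\<gamma>\<close> by
    which \<open>e\<close> stretches distances.\<close>
  define c where "c = (C * (real k + 1))\<^sup>2 * \<gamma>"
  have \<gamma>: "0 < \<gamma>" using pos by (simp add: \<gamma>_def width_def)
  have e_ends: "e 0 = \<alpha> 0" "e 1 = \<beta> 0" by (auto simp: e_def \<gamma>_def width_def)
  have e_mono: "e a \<le> e b" if "a \<le> b" for a b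
    using that \<gamma> by (simp add: e_def)
  have E_split: "E a b = E a d + E d b" if "0 \<le> a" "a \<le> d" "d \<le> b" "b \<le> 1" for a b d
    unfolding E_def
  proof (rule set_integral_Ioo_split)
    have "{e a<..<e b} \<subseteq> {\<alpha> 0<..<\<beta> 0}"
      using e_mono[OF that(1)] e_mono[OF that(4)] by (auto simp: e_ends)
    then show "set_integrable lebesgue {e a<..<e b} (\<lambda>s. (w s)\<^sup>2)"
      using L2_on_subset[OF w] by (auto simp: L2_on_def)
  qed (use that e_mono in auto)
  have E_nonneg: "0 \<le> E a b" for a b
    unfolding E_def by (rule set_integral_nonneg_real) auto
  have "L2_inner (deriv V) (deriv V) \<le> c * E 0 1"
    if M: "mesh M x" and V: "lagrange_interpolant k \<xi> M x (init_v \<alpha> \<beta> u) V" for M x V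
  proof -
    have VS: "V \<in> fe_space k M x" using V by (simp add: lagrange_interpolant_def)
    have V'pp: "piecewise_poly M x (deriv V)" by (rule fe_space_deriv_piecewise_poly[OF VS])
    have int: "set_integrable lebesgue {0<..<1} (\<lambda>y. deriv V y * deriv V y)"
      by (intro piecewise_poly_integrable[OF M] piecewise_poly_intros V'pp)
    have elem: "(LINT y:{x j<..<x (Suc j)}|lebesgue. deriv V y * deriv V y) \<le> c * E (x j) (x (Suc j))"
      if j: "j < M" for j
    proof -
      define h where "h = x (Suc j) - x j"
      have h: "0 < h" using M j by (simp add: mesh_def h_def)
      have xj: "0 \<le> x j" "x (Suc j) \<le> 1" using mesh_mem[OF M] j by auto
      obtain p where p: "degree p \<le> k" "\<And>y. y \<in> {x j..x (Suc j)} \<Longrightarrow> V y = poly p y"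
        using VS j unfolding fe_space_def by blast
      have node: "(poly p (x j + \<xi> r * h) - poly p (x j))\<^sup>2 \<le> h * (\<gamma> * E (x j) (x (Suc j)))"
        if r: "r \<le> k" for r
      proof -
        define z where "z = x j + \<xi> r * h"
        have \<xi>r: "0 \<le> \<xi> r" "\<xi> r \<le> 1" using lagrange_nodes_mem[OF nodes r] by auto
        have le: "\<xi> r * h \<le> h" using \<xi>r h by (intro mult_left_le_one_le) auto
        have z: "x j \<le> z" "z - x j \<le> h" "z \<le> x (Suc j)"
        proof -
          have "x j + h = x (Suc j)" by (simp add: h_def)
          then show "z \<le> x (Suc j)" using le unfolding z_def by linarith
        qed (use \<xi>r h le in \<open>auto simp: z_def\<close>)
        have "V z = init_v \<alpha> \<beta> u z"
          using V j r by (simp add: lagrange_interpolant_def z_def h_def)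
        moreover have "V (x j) = init_v \<alpha> \<beta> u (x j)"
          using V j nodes unfolding lagrange_interpolant_def lagrange_nodes_def by force
        ultimately have "poly p z - poly p (x j) = u (e z) - u (e (x j))"
          using p(2)[of z] p(2)[of "x j"] z by (auto simp: init_v_def e_def \<gamma>_def)
        also have "(u (e z) - u (e (x j)))\<^sup>2 \<le> (e z - e (x j)) * E (x j) z"
          unfolding E_def
        proof (rule inc)
          show "\<alpha> 0 \<le> e (x j)" using e_mono[OF xj(1)] by (simp add: e_ends)
          show "e z \<le> \<beta> 0" using e_mono[of z 1] z xj by (simp add: e_ends)
        qed (use e_mono z in auto)
        \<comment> \<open>The node lies in the element, so its distance from the left end and the
          energy in between are at most those of the full element.\<close>
        also have "\<dots> \<le> (h * \<gamma>) * E (x j) (x (Suc j))"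
        proof (rule mult_mono)
          show "e z - e (x j) \<le> h * \<gamma>"
            using mult_left_mono[OF z(2), of \<gamma>] \<gamma> by (simp add: e_def algebra_simps)
          show "E (x j) z \<le> E (x j) (x (Suc j))"
            using E_split[of "x j" z "x (Suc j)"] E_nonneg[of z "x (Suc j)"] xj z by auto
        qed (use h \<gamma> E_nonneg in auto)
        finally show ?thesis by (simp add: z_def mult.assoc)
      qed
      have "(LINT y:{x j<..<x (Suc j)}|lebesgue. deriv V y * deriv V y) \<le>
        (LINT y:{x j<..<x (Suc j)}|lebesgue. c * E (x j) (x (Suc j)) / h)"
      proof (rule set_integral_mono)
        fix y assume y: "y \<in> {x j<..<x (Suc j)}"
        have "deriv V y = poly (pderiv p) y"
          by (intro DERIV_imp_deriv deriv_piecewise[OF _ y]) (use p in auto)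
        moreover have "(poly (pderiv p) y)\<^sup>2 \<le>
            (C * (real k + 1))\<^sup>2 * (\<gamma> * E (x j) (x (Suc j))) / (x (Suc j) - x j)"
          using h y node
          by (intro lagrange_element_deriv_bound[OF nodes C p(1)]) (auto simp: h_def)
        ultimately show "deriv V y * deriv V y \<le> c * E (x j) (x (Suc j)) / h"
          by (simp add: c_def h_def power2_eq_square mult.assoc)
      next
        show "set_integrable lebesgue {x j<..<x (Suc j)} (\<lambda>y. deriv V y * deriv V y)"
          using int M j by (simp add: mesh_set_integrable_iff)
      qed (intro set_integrable_continuous_Ioo continuous_intros)
      also have "\<dots> = c * E (x j) (x (Suc j))"
        using h by (subst set_integral_const_Ioo) (auto simp: h_def)
      finally show ?thesis .
    qed
    have sumE: "(\<Sum>j<m. E (x j) (x (Suc j))) = E 0 (x m)" if "m \<le> M" for m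
      using that
    proof (induction m)
      case 0
      then show ?case using M by (simp add: E_def set_lebesgue_integral_def mesh_def)
    next
      case (Suc m)
      then show ?case
        using E_split[of 0 "x m" "x (Suc m)"] mesh_mem[OF M, of m] mesh_mem[OF M, of "Suc m"]
          mesh_mono[OF M, of m "Suc m"] by simp
    qed
    have "L2_inner (deriv V) (deriv V) =
      (\<Sum>j<M. LINT y:{x j<..<x (Suc j)}|lebesgue. deriv V y * deriv V y)"
      unfolding L2_inner_def by (rule mesh_set_integral_sum[OF M int])
    also have "\<dots> \<le> (\<Sum>j<M. c * E (x j) (x (Suc j)))"
      by (intro sum_mono elem) auto
    also have "\<dots> = c * E 0 1"
      using sumE[of M] M by (simp add: sum_distrib_left[symmetric] mesh_def)
    finally show ?thesis .
  qed
  moreover have "0 \<le> c * E 0 1" using \<gamma> E_nonneg by (simp add: c_def)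
  ultimately show ?thesis by blast
qed

section \<open>Energy estimates for one step\<close>

lemma L2_inner_self_nonneg: "0 \<le> L2_inner u u"
  unfolding L2_inner_def by (rule set_integral_nonneg_real) simp

lemma fe_space_continuous_on: "V \<in> fe_space k M x \<Longrightarrow> continuous_on {0..1} V"
  by (simp add: fe_space_def)

lemma young_mult:
  fixes a b :: real
  assumes "0 < e"
  shows "a * b \<le> e / 2 * a\<^sup>2 + b\<^sup>2 / (2 * e)"
proof -
  have "0 \<le> (e * a - b)\<^sup>2" by simp
  then have "a * b \<le> ((e * a)\<^sup>2 + b\<^sup>2) / (2 * e)"
    using assms by (simp add: le_divide_eq power2_eq_square algebra_simps)
  also have "\<dots> = e / 2 * a\<^sup>2 + b\<^sup>2 / (2 * e)"
    using assms by (simp add: power2_eq_square field_simps)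
  finally show ?thesis .
qed

lemma coeff_b1_bound:
  assumes "0 < \<gamma>0" "\<gamma>0 < width \<alpha> \<beta> t" "\<bar>Dt T (width \<alpha> \<beta>) t\<bar> \<le> \<gamma>max" "\<bar>Dt T \<alpha> t\<bar> \<le> \<alpha>max"
    and "y \<in> {0..1}"
  shows "\<bar>coeff_b1 T \<alpha> \<beta> y t\<bar> \<le> (\<alpha>max + \<gamma>max) / \<gamma>0"
proof -
  have "\<bar>Dt T (width \<alpha> \<beta>) t * y\<bar> \<le> \<gamma>max * 1"
    unfolding abs_mult using assms by (intro mult_mono) auto
  then have "\<bar>Dt T \<alpha> t + Dt T (width \<alpha> \<beta>) t * y\<bar> \<le> \<alpha>max + \<gamma>max"
    using assms by linarith
  then have "\<bar>Dt T \<alpha> t + Dt T (width \<alpha> \<beta>) t * y\<bar> / width \<alpha> \<beta> t \<le> (\<alpha>max + \<gamma>max) / \<gamma>0"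
    using assms by (intro frac_le) auto
  then show ?thesis
    using assms by (simp add: coeff_b1_def abs_divide)
qed

text \<open>Testing with the increment \<open>U - P\<close> makes the diffusion term telescope, because its
  coefficient is the same for both time levels within one step.\<close>

lemma energy_step:
  assumes M: "mesh M x" and U: "U \<in> fe_space k M x" and P: "P \<in> fe_space k M x"
    and g: "L2_on {0<..<1} g" and "0 < \<delta>" "0 \<le> \<kappa>"
    and b: "piecewise_poly M x b" "\<And>y. y \<in> {0<..<1} \<Longrightarrow> \<bar>b y\<bar> \<le> B"
    and eq: "L2_inner (\<lambda>y. (U y - P y) / \<delta>) (\<lambda>y. U y - P y)
      + \<kappa> * L2_inner (deriv U) (deriv (\<lambda>y. U y - P y))
      - L2_inner (\<lambda>y. b y * deriv U y) (\<lambda>y. U y - P y) = L2_inner g (\<lambda>y. U y - P y)"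
  shows "\<kappa> * (L2_inner (deriv U) (deriv U) - L2_inner (deriv P) (deriv P)) \<le>
    \<delta> * (B\<^sup>2 * L2_inner (deriv U) (deriv U) + (LINT y:{0<..<1}|lebesgue. (g y)\<^sup>2))"
proof -
  define W where "W y = U y - P y" for y
  have W: "W \<in> fe_space k M x" using fe_space_diff[OF U P] by (simp add: W_def[abs_def])
  note pp = piecewise_poly_intros b(1) fe_space_piecewise_poly[OF W]
    fe_space_piecewise_poly[OF U] fe_space_piecewise_poly[OF P]
    fe_space_deriv_piecewise_poly[OF U] fe_space_deriv_piecewise_poly[OF P]
    fe_space_deriv_piecewise_poly[OF W]
  note int = piecewise_poly_integrable[OF M]
  define A where "A f = (LINT y:{0<..<1}|lebesgue. f y)" for f :: "real \<Rightarrow> real"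
  have t1: "L2_inner (\<lambda>y. (U y - P y) / \<delta>) W = A (\<lambda>y. (W y)\<^sup>2) / \<delta>"
    by (simp add: L2_inner_def A_def W_def[symmetric] power2_eq_square)
  have "L2_inner (deriv U) (deriv W) = A (\<lambda>y. deriv U y * (deriv U y - deriv P y))"
    unfolding L2_inner_def A_def W_def[abs_def]
    by (rule piecewise_poly_integral_cong[OF M])
      (auto intro!: pp fe_space_deriv_piecewise_poly[OF fe_space_diff[OF U P]]
        simp: fe_space_deriv_diff[OF U P])
  \<comment> \<open>The product is half the difference of the two squares plus half of
    \<open>(deriv U y - deriv P y)\<^sup>2\<close>, which is dropped.\<close>
  also have "\<dots> \<ge> A (\<lambda>y. 1 / 2 * (deriv U y * deriv U y) - 1 / 2 * (deriv P y * deriv P y))"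
    unfolding A_def
  proof (rule set_integral_mono)
    fix y
    have "0 \<le> (deriv U y - deriv P y)\<^sup>2" by simp
    then show "1 / 2 * (deriv U y * deriv U y) - 1 / 2 * (deriv P y * deriv P y) \<le>
        deriv U y * (deriv U y - deriv P y)"
      by (simp add: power2_eq_square algebra_simps)
  qed (auto intro!: int pp)
  also have "A (\<lambda>y. 1 / 2 * (deriv U y * deriv U y) - 1 / 2 * (deriv P y * deriv P y)) =
      1 / 2 * (L2_inner (deriv U) (deriv U) - L2_inner (deriv P) (deriv P))"
    unfolding A_def L2_inner_def
    by (subst set_integral_diff) (auto intro!: int pp)
  finally have t2: "1 / 2 * (L2_inner (deriv U) (deriv U) - L2_inner (deriv P) (deriv P)) \<le>
      L2_inner (deriv U) (deriv W)" .
  \<comment> \<open>Young's inequality with weight \<open>\<delta>\<close>: convection here and the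
    source below each cost half of the time difference term, which they use up exactly. Nothing is
    taken from diffusion, which only supplies the difference of energies.\<close>
  have "L2_inner (\<lambda>y. b y * deriv U y) W \<le>
      A (\<lambda>y. \<delta> / 2 * B\<^sup>2 * (deriv U y * deriv U y) + 1 / (2 * \<delta>) * (W y)\<^sup>2)"
    unfolding A_def L2_inner_def
  proof (rule set_integral_mono)
    fix y :: real assume y: "y \<in> {0<..<1}"
    have "(b y)\<^sup>2 \<le> B\<^sup>2" using power_mono[OF b(2)[OF y], of 2] by simp
    then have "\<delta> / 2 * ((b y)\<^sup>2 * (deriv U y)\<^sup>2) \<le> \<delta> / 2 * (B\<^sup>2 * (deriv U y)\<^sup>2)"
      using \<open>0 < \<delta>\<close> by (intro mult_left_mono mult_right_mono) auto
    then show "b y * deriv U y * W y \<le> \<delta> / 2 * B\<^sup>2 * (deriv U y * deriv U y) + 1 / (2 * \<delta>) * (W y)\<^sup>2"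
      using young_mult[OF \<open>0 < \<delta>\<close>, of "b y * deriv U y" "W y"]
      by (simp add: power_mult_distrib power2_eq_square mult_ac)
  qed (intro int pp)+
  also have "\<dots> = \<delta> / 2 * B\<^sup>2 * L2_inner (deriv U) (deriv U) + 1 / (2 * \<delta>) * A (\<lambda>y. (W y)\<^sup>2)"
    unfolding A_def L2_inner_def by (subst set_integral_add) (auto intro!: int pp)
  finally have t3: "L2_inner (\<lambda>y. b y * deriv U y) W \<le>
      \<delta> / 2 * B\<^sup>2 * L2_inner (deriv U) (deriv U) + 1 / (2 * \<delta>) * A (\<lambda>y. (W y)\<^sup>2)" .
  have g2: "set_integrable lebesgue {0<..<1} (\<lambda>y. (g y)\<^sup>2)" using g by (simp add: L2_on_def)
  have "L2_inner g W \<le> A (\<lambda>y. \<delta> / 2 * (g y)\<^sup>2 + 1 / (2 * \<delta>) * (W y)\<^sup>2)"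
    unfolding A_def L2_inner_def
  proof (rule set_integral_mono)
    show "set_integrable lebesgue {0<..<1} (\<lambda>y. g y * W y)"
      by (intro L2_on_mult_integrable g L2_on_continuous_Ioo fe_space_continuous_on[OF W])
    show "g y * W y \<le> \<delta> / 2 * (g y)\<^sup>2 + 1 / (2 * \<delta>) * (W y)\<^sup>2" for y
      using young_mult[OF \<open>0 < \<delta>\<close>, of "g y" "W y"] by simp
    show "set_integrable lebesgue {0<..<1} (\<lambda>y. \<delta> / 2 * (g y)\<^sup>2 + 1 / (2 * \<delta>) * (W y)\<^sup>2)"
      by (intro set_integral_add(1) set_integrable_mult_right g2 int pp)
  qed
  also have "\<dots> = \<delta> / 2 * A (\<lambda>y. (g y)\<^sup>2) + 1 / (2 * \<delta>) * A (\<lambda>y. (W y)\<^sup>2)"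
    unfolding A_def
    by (subst set_integral_add, intro set_integrable_mult_right g2, intro int pp, simp)
  finally have t4: "L2_inner g W \<le> \<delta> / 2 * A (\<lambda>y. (g y)\<^sup>2) + 1 / (2 * \<delta>) * A (\<lambda>y. (W y)\<^sup>2)" .
  have "A (\<lambda>y. (W y)\<^sup>2) / \<delta> = 1 / (2 * \<delta>) * A (\<lambda>y. (W y)\<^sup>2) + 1 / (2 * \<delta>) * A (\<lambda>y. (W y)\<^sup>2)"
    using \<open>0 < \<delta>\<close> by (simp add: field_simps)
  then have "\<kappa> * L2_inner (deriv U) (deriv W) \<le>
      \<delta> / 2 * B\<^sup>2 * L2_inner (deriv U) (deriv U) + \<delta> / 2 * A (\<lambda>y. (g y)\<^sup>2)"
    using eq t1 t3 t4 unfolding W_def[abs_def, symmetric] by linarith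
  with mult_left_mono[OF t2 \<open>0 \<le> \<kappa>\<close>]
  have "\<kappa> * (1 / 2 * (L2_inner (deriv U) (deriv U) - L2_inner (deriv P) (deriv P))) \<le>
      \<delta> / 2 * B\<^sup>2 * L2_inner (deriv U) (deriv U) + \<delta> / 2 * A (\<lambda>y. (g y)\<^sup>2)"
    by linarith
  then show ?thesis
    by (simp add: A_def algebra_simps)
qed

text \<open>The scheme is implicit, so \<open>E (Suc m)\<close> also stands on the right and has to
  be absorbed. With \<open>r = C * \<delta>\<close> at most one half,
  \<open>(1 + 2 * r) * (1 - r) = 1 + r * (1 - 2 * r)\<close> is at least 1, so division by
  \<open>1 - r\<close> costs at most the factor \<open>1 + 2 * r\<close>, hence at most
  \<open>exp (2 * r)\<close>; this is the 2 in the exponent.\<close>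

lemma discrete_gronwall:
  fixes E G :: "nat \<Rightarrow> real"
  assumes "0 < \<delta>" "0 \<le> C" "C * \<delta> \<le> 1 / 2" "\<And>m. 0 \<le> E m" "\<And>m. 0 \<le> G m"
    and step: "\<And>m. m < p \<Longrightarrow> E (Suc m) - E m \<le> C * \<delta> * (E (Suc m) + G (Suc m))"
  shows "E p \<le> exp (2 * C * \<delta> * p) * (E 0 + C * (\<Sum>m=1..p. \<delta> * G m))"
  using step
proof (induction p)
  case (Suc p)
  define S where "S = (\<lambda>p. E 0 + C * (\<Sum>m=1..p. \<delta> * G m))"
  define r where "r = C * \<delta>"
  have r: "0 \<le> r" "r \<le> 1 / 2" using assms by (auto simp: r_def)
  have S: "S (Suc p) = S p + r * G (Suc p)"
    by (simp add: S_def r_def algebra_simps)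
  have IH: "E p \<le> exp (2 * r * p) * S p"
    using Suc by (simp add: S_def r_def mult.assoc)
  have "E (Suc p) * (1 - r) \<le> E p + r * G (Suc p)"
    using Suc.prems[of p] by (simp add: r_def algebra_simps)
  also have "\<dots> \<le> exp (2 * r * p) * S p + exp (2 * r * p) * (r * G (Suc p))"
    using IH mult_right_mono[of 1 "exp (2 * r * p)" "r * G (Suc p)"] r assms(5)[of "Suc p"]
    by (intro add_mono) auto
  also have "\<dots> = exp (2 * r * p) * S (Suc p)" by (simp add: S algebra_simps)
  finally have e: "E (Suc p) * (1 - r) \<le> exp (2 * r * p) * S (Suc p)" .
  have "1 \<le> (1 + 2 * r) * (1 - r)"
    using r mult_nonneg_nonneg[of r "1 - 2 * r"] by (simp add: algebra_simps)
  then have "E (Suc p) \<le> E (Suc p) * ((1 + 2 * r) * (1 - r))"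
    using assms(4)[of "Suc p"] by (simp add: mult_le_cancel_left1)
  also have "\<dots> \<le> (1 + 2 * r) * (exp (2 * r * p) * S (Suc p))"
    using mult_left_mono[OF e, of "1 + 2 * r"] r by (simp add: mult_ac)
  also have "\<dots> \<le> exp (2 * r) * (exp (2 * r * p) * S (Suc p))"
  proof (rule mult_right_mono)
    show "1 + 2 * r \<le> exp (2 * r)" by (rule exp_ge_add_one_self)
    show "0 \<le> exp (2 * r * p) * S (Suc p)"
      using assms by (auto simp: S_def intro!: add_nonneg_nonneg mult_nonneg_nonneg sum_nonneg)
  qed
  also have "\<dots> = exp (2 * r * Suc p) * S (Suc p)"
    by (simp add: exp_add[symmetric] algebra_simps)
  finally show ?case by (simp add: S_def r_def mult.assoc)
qed simp

text \<open>One energy step divided by the lower bound \<open>m\<^sub>a / \<gamma>1\<^sup>2\<close>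
  of the diffusion coefficient has the form that the Gronwall argument accepts, with
  \<open>C\<close> as its constant. The elapsed time is at most \<open>T\<close> and the source sum
  at most \<open>K\<close>, so neither the mesh nor \<open>\<delta>\<close> enters beyond the
  initial energy.\<close>

lemma euler_energy_bound:
  fixes a :: "'n::finite \<Rightarrow> real ^ 'n \<Rightarrow> real"
  assumes "0 < \<gamma>0"
    and width: "\<And>t. t \<in> {0..T} \<Longrightarrow> \<gamma>0 < width \<alpha> \<beta> t \<and> width \<alpha> \<beta> t < \<gamma>1"
    and b1: "\<And>t y. t \<in> {0..T} \<Longrightarrow> y \<in> {0..1} \<Longrightarrow> \<bar>coeff_b1 T \<alpha> \<beta> y t\<bar> \<le> B"
    and "0 < m\<^sub>a" and a: "\<And>s. m\<^sub>a \<le> a i s"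
    and gL2: "\<And>N n. n \<in> {1..N} \<Longrightarrow> L2_on {0<..<1} (\<lambda>y. source_g \<alpha> \<beta> (f i) y (real n * (T / real N)))"
    and gK: "\<And>N. (\<Sum>n=1..N. T / real N *
        (LINT y:{0<..<1}|lebesgue. (source_g \<alpha> \<beta> (f i) y (real n * (T / real N)))\<^sup>2)) \<le> K"
    and C: "C = \<gamma>1\<^sup>2 / m\<^sub>a * (B\<^sup>2 + 1)"
    and M: "mesh M x" and "0 < \<delta>" "T = real N * \<delta>" "C * \<delta> \<le> 1 / 2" "p \<le> N"
    and V0: "V 0 i \<in> fe_space k M x"
    and step: "\<And>m. m < p \<Longrightarrow> euler_step T \<alpha> \<beta> a f (fe_space k M x) \<delta> m (V m) (V (Suc m))"
  shows "L2_inner (deriv (V p i)) (deriv (V p i)) \<le>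
    exp (2 * C * T) * (L2_inner (deriv (V 0 i)) (deriv (V 0 i)) + C * K)"
proof (cases "p = 0")
  case True
  \<comment> \<open>If no step is taken, \<open>N\<close> may be 0 and \<open>T / real N\<close> is
    then 0 instead of \<open>\<delta>\<close>; hence the separate case. The empty sum at
    \<open>N = 0\<close> shows that \<open>K\<close> is nonnegative.\<close>
  have "0 \<le> K" using gK[of 0] by simp
  have "0 \<le> C" "0 \<le> T" using assms by auto
  then have "1 \<le> exp (2 * C * T)" by simp
  moreover have "L2_inner (deriv (V 0 i)) (deriv (V 0 i)) \<le> L2_inner (deriv (V 0 i)) (deriv (V 0 i)) + C * K"
    using \<open>0 \<le> K\<close> \<open>0 \<le> C\<close> by simp
  ultimately show ?thesis
    using True mult_mono[of 1 "exp (2 * C * T)" "L2_inner (deriv (V 0 i)) (deriv (V 0 i))"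
        "L2_inner (deriv (V 0 i)) (deriv (V 0 i)) + C * K"] by (simp add: L2_inner_self_nonneg)
next
  case False
  then have N: "0 < N" using \<open>p \<le> N\<close> by simp
  have \<delta>: "T / real N = \<delta>" using N \<open>T = real N * \<delta>\<close> by simp
  define E where "E m = L2_inner (deriv (V m i)) (deriv (V m i))" for m
  define G where "G n = (LINT y:{0<..<1}|lebesgue. (source_g \<alpha> \<beta> (f i) y (real n * \<delta>))\<^sup>2)" for n
  have G0: "0 \<le> G n" for n unfolding G_def by (rule set_integral_nonneg_real) simp
  have E0: "0 \<le> E m" for m unfolding E_def by (rule L2_inner_self_nonneg)
  have C0: "0 \<le> C" using assms by simp
  have VS: "V m i \<in> fe_space k M x" if "m \<le> p" for m
    using that V0 step by (cases m) (auto simp: euler_step_def Suc_le_eq)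
  have "E (Suc m) - E m \<le> C * \<delta> * (E (Suc m) + G (Suc m))" if m: "m < p" for m
  proof -
    define t where "t = real (Suc m) * \<delta>"
    define \<kappa> where "\<kappa> = coeff_b2 \<alpha> \<beta> t * a i (\<chi> j. nonlocal_l \<alpha> \<beta> t (V (Suc m) j))"
    have "real (Suc m) \<le> real N" using m \<open>p \<le> N\<close> by simp
    then have t: "t \<in> {0..T}"
      using \<open>0 < \<delta>\<close> \<open>T = real N * \<delta>\<close> by (auto simp: t_def intro: mult_right_mono)
    have "L2_on {0<..<1} (\<lambda>y. source_g \<alpha> \<beta> (f i) y t)"
      using gL2[of "Suc m" N] m \<open>p \<le> N\<close> unfolding \<delta> t_def by auto
    have w: "0 < width \<alpha> \<beta> t" "width \<alpha> \<beta> t \<le> \<gamma>1" using width[OF t] \<open>0 < \<gamma>0\<close> by auto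
    have "(width \<alpha> \<beta> t)\<^sup>2 \<le> \<gamma>1\<^sup>2" using w by (intro power_mono) auto
    then have "1 / \<gamma>1\<^sup>2 \<le> coeff_b2 \<alpha> \<beta> t"
      unfolding coeff_b2_def using w by (intro frac_le) auto
    then have \<kappa>: "m\<^sub>a / \<gamma>1\<^sup>2 \<le> \<kappa>"
      unfolding \<kappa>_def using mult_mono[of "1 / \<gamma>1\<^sup>2" "coeff_b2 \<alpha> \<beta> t" m\<^sub>a] a \<open>0 < m\<^sub>a\<close>
      by (simp add: coeff_b2_def)
    have \<gamma>1: "0 < \<gamma>1" using w by simp
    have q: "0 < m\<^sub>a / \<gamma>1\<^sup>2" using \<open>0 < m\<^sub>a\<close> \<gamma>1 by simp
    have "\<kappa> * (E (Suc m) - E m) \<le> \<delta> * (B\<^sup>2 * E (Suc m) + G (Suc m))"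
      unfolding E_def G_def t_def[symmetric]
    proof (rule energy_step[OF M])
      show "V (Suc m) i \<in> fe_space k M x" "V m i \<in> fe_space k M x" using VS m by auto
      then have "(\<lambda>y. V (Suc m) i y - V m i y) \<in> fe_space k M x" by (rule fe_space_diff)
      then show "L2_inner (\<lambda>y. (V (Suc m) i y - V m i y) / \<delta>) (\<lambda>y. V (Suc m) i y - V m i y)
        + \<kappa> * L2_inner (deriv (V (Suc m) i)) (deriv (\<lambda>y. V (Suc m) i y - V m i y))
        - L2_inner (\<lambda>y. coeff_b1 T \<alpha> \<beta> y t * deriv (V (Suc m) i) y) (\<lambda>y. V (Suc m) i y - V m i y)
        = L2_inner (\<lambda>y. source_g \<alpha> \<beta> (f i) y t) (\<lambda>y. V (Suc m) i y - V m i y)"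
        using step[OF m] by (simp add: euler_step_def Let_def \<kappa>_def t_def)
    qed (use \<open>0 < \<delta>\<close> \<kappa> q t b1 in
        \<open>auto intro: piecewise_poly_coeff_b1 \<open>L2_on {0<..<1} (\<lambda>y. source_g \<alpha> \<beta> (f i) y t)\<close>\<close>)
    also have "\<dots> \<le> \<delta> * ((B\<^sup>2 + 1) * (E (Suc m) + G (Suc m)))"
      using \<open>0 < \<delta>\<close> E0[of "Suc m"] G0[of "Suc m"] by (intro mult_left_mono) (auto simp: algebra_simps)
    finally have e: "\<kappa> * (E (Suc m) - E m) \<le> \<delta> * ((B\<^sup>2 + 1) * (E (Suc m) + G (Suc m)))" .
    \<comment> \<open>Only a lower bound of \<open>\<kappa>\<close> is at hand, and it can replace
      \<open>\<kappa>\<close> when the energy grows. When it does not grow, the claim holds because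
      its right-hand side is nonnegative.\<close>
    show ?thesis
    proof (cases "E (Suc m) - E m \<le> 0")
      case True
      then show ?thesis
        using C0 \<open>0 < \<delta>\<close> E0[of "Suc m"] G0[of "Suc m"] by (intro order.trans[OF True]) auto
    next
      case False
      then have "m\<^sub>a / \<gamma>1\<^sup>2 * (E (Suc m) - E m) \<le> \<kappa> * (E (Suc m) - E m)"
        using \<kappa> by (intro mult_right_mono) auto
      also note e
      finally have "m\<^sub>a * (E (Suc m) - E m) \<le> \<gamma>1\<^sup>2 * (\<delta> * ((B\<^sup>2 + 1) * (E (Suc m) + G (Suc m))))"
        using \<gamma>1 by (simp add: divide_le_eq mult.commute)
      then show ?thesis
        unfolding C using \<open>0 < m\<^sub>a\<close> by (simp add: le_divide_eq mult_ac)
    qed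
  qed
  then have "E p \<le> exp (2 * C * \<delta> * p) * (E 0 + C * (\<Sum>m=1..p. \<delta> * G m))"
    using \<open>0 < \<delta>\<close> C0 E0 G0 \<open>C * \<delta> \<le> 1 / 2\<close> by (intro discrete_gronwall) auto
  also have "\<dots> \<le> exp (2 * C * T) * (E 0 + C * K)"
  proof (rule mult_mono)
    have "\<delta> * real p \<le> T" using \<open>p \<le> N\<close> \<open>0 < \<delta>\<close> \<open>T = real N * \<delta>\<close> by simp
    then show "exp (2 * C * \<delta> * real p) \<le> exp (2 * C * T)"
      using mult_left_mono[of "\<delta> * real p" T "2 * C"] C0 by (simp add: mult.assoc)
    have "(\<Sum>m=1..p. \<delta> * G m) \<le> (\<Sum>m=1..N. \<delta> * G m)"
      using \<open>p \<le> N\<close> \<open>0 < \<delta>\<close> G0 by (intro sum_mono2) auto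
    also have "\<dots> \<le> K" using gK[of N] unfolding \<delta> G_def .
    finally show "E 0 + C * (\<Sum>m=1..p. \<delta> * G m) \<le> E 0 + C * K"
      using C0 by (simp add: mult_left_mono)
  qed (use C0 E0 G0 \<open>0 < \<delta>\<close> in \<open>auto intro!: add_nonneg_nonneg mult_nonneg_nonneg sum_nonneg\<close>)
  finally show ?thesis unfolding E_def .
qed

text \<open>Subtracting the equations removes \<open>P\<close> and \<open>r\<close>, and with
  \<open>Z = X - Y\<close> the diffusion terms combine to
  \<open>\<kappa> (Z', Z') + (\<kappa> - \<kappa>') (Y', Z')\<close>. Convection and the coefficient
  difference each take \<open>\<kappa>0 / 2\<close> of the squared norm of \<open>Z'\<close>, which
  together is within the available diffusion. The splitting is asymmetric: only
  \<open>\<kappa>\<close> is bounded below and only the energy of \<open>Y\<close> appears.\<close>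

lemma euler_component_difference:
  assumes M: "mesh M x" and X: "X \<in> fe_space k M x" and Y: "Y \<in> fe_space k M x"
    and P: "P \<in> fe_space k M x" and "0 < \<delta>" "0 < \<kappa>0" "\<kappa>0 \<le> \<kappa>"
    and b: "piecewise_poly M x b" "\<And>y. y \<in> {0<..<1} \<Longrightarrow> \<bar>b y\<bar> \<le> B"
    and eqX: "L2_inner (\<lambda>y. (X y - P y) / \<delta>) (\<lambda>y. X y - Y y)
      + \<kappa> * L2_inner (deriv X) (deriv (\<lambda>y. X y - Y y))
      - L2_inner (\<lambda>y. b y * deriv X y) (\<lambda>y. X y - Y y) = r"
    and eqY: "L2_inner (\<lambda>y. (Y y - P y) / \<delta>) (\<lambda>y. X y - Y y)
      + \<kappa>' * L2_inner (deriv Y) (deriv (\<lambda>y. X y - Y y))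
      - L2_inner (\<lambda>y. b y * deriv Y y) (\<lambda>y. X y - Y y) = r"
  shows "(LINT y:{0<..<1}|lebesgue. (X y - Y y)\<^sup>2) \<le>
    \<delta> / (2 * \<kappa>0) * ((\<kappa> - \<kappa>')\<^sup>2 * L2_inner (deriv Y) (deriv Y) +
      B\<^sup>2 * (LINT y:{0<..<1}|lebesgue. (X y - Y y)\<^sup>2))"
proof -
  define Z where "Z y = X y - Y y" for y
  have Z: "Z \<in> fe_space k M x" using fe_space_diff[OF X Y] by (simp add: Z_def[abs_def])
  note pp = piecewise_poly_intros b(1) fe_space_piecewise_poly[OF X]
    fe_space_piecewise_poly[OF Y] fe_space_piecewise_poly[OF P] fe_space_piecewise_poly[OF Z]
    fe_space_deriv_piecewise_poly[OF X] fe_space_deriv_piecewise_poly[OF Y]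
    fe_space_deriv_piecewise_poly[OF Z]
  note int = piecewise_poly_integrable[OF M]
  define A where "A f = (LINT y:{0<..<1}|lebesgue. f y)" for f :: "real \<Rightarrow> real"
  have dZ: "deriv Z y = deriv X y - deriv Y y" if "j < M" "y \<in> {x j<..<x (Suc j)}" for j y
    unfolding Z_def[abs_def] by (rule fe_space_deriv_diff[OF X Y that])
  have t1: "L2_inner (\<lambda>y. (X y - P y) / \<delta>) Z - L2_inner (\<lambda>y. (Y y - P y) / \<delta>) Z = A (\<lambda>y. (Z y)\<^sup>2) / \<delta>"
    unfolding L2_inner_def A_def set_integral_divide_zero[symmetric]
    by (subst set_integral_diff(2)[symmetric], (intro int pp)+)
      (simp add: Z_def power2_eq_square diff_divide_distrib add_divide_distrib algebra_simps)
  have "L2_inner (deriv X) (deriv Z) = A (\<lambda>y. deriv Z y * deriv Z y + deriv Y y * deriv Z y)"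
    unfolding L2_inner_def A_def
    by (rule piecewise_poly_integral_cong[OF M]) (auto intro!: pp simp: dZ algebra_simps)
  also have "\<dots> = L2_inner (deriv Z) (deriv Z) + L2_inner (deriv Y) (deriv Z)"
    unfolding L2_inner_def A_def by (intro set_integral_add int pp)
  finally have t2: "L2_inner (deriv X) (deriv Z) =
      L2_inner (deriv Z) (deriv Z) + L2_inner (deriv Y) (deriv Z)" .
  have "L2_inner (\<lambda>y. b y * deriv X y) Z - L2_inner (\<lambda>y. b y * deriv Y y) Z =
      A (\<lambda>y. b y * deriv X y * Z y - b y * deriv Y y * Z y)"
    unfolding L2_inner_def A_def by (rule set_integral_diff(2)[symmetric]; intro int pp)
  also have "\<dots> = A (\<lambda>y. b y * deriv Z y * Z y)"
    unfolding A_def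
    by (rule piecewise_poly_integral_cong[OF M]) (auto intro!: pp simp: dZ algebra_simps)
  also have "\<dots> \<le> A (\<lambda>y. \<kappa>0 / 2 * (deriv Z y * deriv Z y) + B\<^sup>2 / (2 * \<kappa>0) * (Z y)\<^sup>2)"
    unfolding A_def
  proof (rule set_integral_mono)
    fix y :: real assume y: "y \<in> {0<..<1}"
    have "(b y)\<^sup>2 \<le> B\<^sup>2" using power_mono[OF b(2)[OF y], of 2] by simp
    then have "(b y)\<^sup>2 * (Z y)\<^sup>2 / (2 * \<kappa>0) \<le> B\<^sup>2 * (Z y)\<^sup>2 / (2 * \<kappa>0)"
      using \<open>0 < \<kappa>0\<close> by (intro divide_right_mono mult_right_mono) auto
    then show "b y * deriv Z y * Z y \<le> \<kappa>0 / 2 * (deriv Z y * deriv Z y) + B\<^sup>2 / (2 * \<kappa>0) * (Z y)\<^sup>2"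
      using young_mult[OF \<open>0 < \<kappa>0\<close>, of "deriv Z y" "b y * Z y"]
      by (simp add: power_mult_distrib power2_eq_square mult_ac)
  qed (intro int pp)+
  also have "\<dots> = \<kappa>0 / 2 * L2_inner (deriv Z) (deriv Z) + B\<^sup>2 / (2 * \<kappa>0) * A (\<lambda>y. (Z y)\<^sup>2)"
    unfolding A_def L2_inner_def by (subst set_integral_add) (auto intro!: int pp)
  finally have t3: "L2_inner (\<lambda>y. b y * deriv X y) Z - L2_inner (\<lambda>y. b y * deriv Y y) Z \<le>
      \<kappa>0 / 2 * L2_inner (deriv Z) (deriv Z) + B\<^sup>2 / (2 * \<kappa>0) * A (\<lambda>y. (Z y)\<^sup>2)" .
  \<comment> \<open>The sign is that of the term after it has moved to the right-hand side.\<close>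
  define d where "d = \<kappa>' - \<kappa>"
  have "d * L2_inner (deriv Y) (deriv Z) = A (\<lambda>y. d * (deriv Y y * deriv Z y))"
    by (simp add: A_def L2_inner_def)
  also have "\<dots> \<le> A (\<lambda>y. \<kappa>0 / 2 * (deriv Z y * deriv Z y) + d\<^sup>2 / (2 * \<kappa>0) * (deriv Y y * deriv Y y))"
    unfolding A_def
  proof (rule set_integral_mono)
    show "d * (deriv Y y * deriv Z y) \<le> \<kappa>0 / 2 * (deriv Z y * deriv Z y) + d\<^sup>2 / (2 * \<kappa>0) * (deriv Y y * deriv Y y)" for y
      using young_mult[OF \<open>0 < \<kappa>0\<close>, of "deriv Z y" "d * deriv Y y"]
      by (simp add: power_mult_distrib power2_eq_square mult_ac)
  qed (intro int pp)+
  also have "\<dots> = \<kappa>0 / 2 * L2_inner (deriv Z) (deriv Z) + d\<^sup>2 / (2 * \<kappa>0) * L2_inner (deriv Y) (deriv Y)"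
    unfolding A_def L2_inner_def by (subst set_integral_add) (auto intro!: int pp)
  finally have t4: "d * L2_inner (deriv Y) (deriv Z) \<le>
      \<kappa>0 / 2 * L2_inner (deriv Z) (deriv Z) + d\<^sup>2 / (2 * \<kappa>0) * L2_inner (deriv Y) (deriv Y)" .
  have t5: "\<kappa>0 * L2_inner (deriv Z) (deriv Z) \<le> \<kappa> * L2_inner (deriv Z) (deriv Z)"
    using \<open>\<kappa>0 \<le> \<kappa>\<close> by (intro mult_right_mono L2_inner_self_nonneg)
  have t6: "\<kappa> * L2_inner (deriv X) (deriv Z) - \<kappa>' * L2_inner (deriv Y) (deriv Z) =
      \<kappa> * L2_inner (deriv Z) (deriv Z) - d * L2_inner (deriv Y) (deriv Z)"
    unfolding t2 d_def by (simp add: algebra_simps)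
  have "A (\<lambda>y. (Z y)\<^sup>2) / \<delta> \<le> d\<^sup>2 / (2 * \<kappa>0) * L2_inner (deriv Y) (deriv Y) + B\<^sup>2 / (2 * \<kappa>0) * A (\<lambda>y. (Z y)\<^sup>2)"
    using eqX eqY t1 t3 t4 t5 t6 unfolding Z_def[abs_def, symmetric] by linarith
  then have "A (\<lambda>y. (Z y)\<^sup>2) \<le> \<delta> * (d\<^sup>2 / (2 * \<kappa>0) * L2_inner (deriv Y) (deriv Y) + B\<^sup>2 / (2 * \<kappa>0) * A (\<lambda>y. (Z y)\<^sup>2))"
    using \<open>0 < \<delta>\<close> by (simp add: pos_divide_le_eq mult.commute)
  also have "\<dots> = \<delta> / (2 * \<kappa>0) * ((\<kappa> - \<kappa>')\<^sup>2 * L2_inner (deriv Y) (deriv Y) + B\<^sup>2 * A (\<lambda>y. (Z y)\<^sup>2))"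
    by (simp add: d_def power2_commute[of \<kappa>' \<kappa>] algebra_simps add_divide_distrib)
  finally show ?thesis by (simp add: A_def Z_def)
qed

section \<open>Uniqueness\<close>

text \<open>Cauchy-Schwarz on the unit interval. The nonlocal terms, and with them the coefficients,
  are thus controlled by the L2 distance without derivatives, which is why the time difference term
  can dominate them.\<close>

lemma nonlocal_l_diff_square_le:
  assumes "continuous_on {0..1} u" "continuous_on {0..1} v"
  shows "(nonlocal_l \<alpha> \<beta> t u - nonlocal_l \<alpha> \<beta> t v)\<^sup>2 \<le>
    (width \<alpha> \<beta> t)\<^sup>2 * (LINT y:{0<..<1}|lebesgue. (u y - v y)\<^sup>2)"
proof -
  have "nonlocal_l \<alpha> \<beta> t u - nonlocal_l \<alpha> \<beta> t v =
      width \<alpha> \<beta> t * (LINT y:{0<..<1}|lebesgue. u y - v y)"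
    unfolding nonlocal_l_def
    by (subst set_integral_diff) (auto intro!: set_integrable_continuous_Ioo assms simp: algebra_simps)
  moreover have "(LINT y:{0<..<1}|lebesgue. u y - v y)\<^sup>2 \<le>
      (1 - 0) * (LINT y:{0<..<1}|lebesgue. (u y - v y)\<^sup>2)"
    by (intro integral_Ioo_square_le L2_on_continuous_Ioo continuous_on_diff assms) simp
  ultimately show ?thesis
    by (simp add: power_mult_distrib mult_left_mono)
qed

text \<open>The relation between \<open>\<delta>\<close> and the squared mesh size is expressed by
  fixed constants \<open>c1\<close> and \<open>c2\<close>, and \<open>\<delta>0\<close> is chosen
  before the mesh and the number of steps. Equality is claimed on \<open>[0,1]\<close> because
  finite element functions are determined only there.\<close>

theorem theorem8:
  fixes T \<gamma>0 \<gamma>1 \<gamma>max \<alpha>max m\<^sub>a M\<^sub>a c1 c2 :: real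
    and \<alpha> \<beta> :: "real \<Rightarrow> real"
    and a :: "'n::finite \<Rightarrow> real ^ 'n \<Rightarrow> real"
    and f :: "'n \<Rightarrow> real \<Rightarrow> real \<Rightarrow> real"
    and u0 :: "'n \<Rightarrow> real \<Rightarrow> real"
    and k :: nat and \<xi> :: "nat \<Rightarrow> real"
  assumes "0 < T"
    and "C2_on T \<alpha>" and "C2_on T \<beta>"
    and "L2_on {0<..<T} (Dt T \<alpha>)" and "L2_on {0<..<T} (Dt T \<beta>)"
    and "0 < \<gamma>0"
    and "\<forall>t\<in>{0..T}. \<gamma>0 < width \<alpha> \<beta> t \<and> width \<alpha> \<beta> t < \<gamma>1"
    and "\<forall>t\<in>{0..T}. \<bar>Dt T (width \<alpha> \<beta>) t\<bar> \<le> \<gamma>max"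
    and "\<forall>t\<in>{0..T}. \<bar>Dt T \<alpha> t\<bar> \<le> \<alpha>max"
    and "\<forall>i. u0 i \<in> H10 (\<alpha> 0) (\<beta> 0)"
    and "\<forall>i. L2_on {(x, t). 0 < t \<and> t < T \<and> \<alpha> t < x \<and> x < \<beta> t} (\<lambda>(x, t). f i x t)"
    and "\<forall>i. L2_time_samples T (source_g \<alpha> \<beta> (f i))"
    and "\<forall>i. \<exists>L. L-lipschitz_on UNIV (a i)"
    and "0 < m\<^sub>a" and "\<forall>i s. m\<^sub>a \<le> a i s \<and> a i s \<le> M\<^sub>a"
    and "1 \<le> k" and "lagrange_nodes k \<xi>"
    and "0 < c1" and "0 < c2"
  shows "\<exists>\<delta>0>0. \<forall>M x N \<delta>. mesh M x \<and> 0 < \<delta> \<and> T = real N * \<delta> \<and> \<delta> \<le> \<delta>0 \<and>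
           c1 * (mesh_size M x)\<^sup>2 \<le> \<delta> \<and> \<delta> \<le> c2 * (mesh_size M x)\<^sup>2 \<longrightarrow>
           (\<forall>n<N. \<forall>V X Y.
              (\<forall>i. lagrange_interpolant k \<xi> M x (init_v \<alpha> \<beta> (u0 i)) (V 0 i)) \<and>
              (\<forall>m<n. euler_step T \<alpha> \<beta> a f (fe_space k M x) \<delta> m (V m) (V (Suc m))) \<and>
              euler_step T \<alpha> \<beta> a f (fe_space k M x) \<delta> n (V n) X \<and>
              euler_step T \<alpha> \<beta> a f (fe_space k M x) \<delta> n (V n) Y \<longrightarrow>
              (\<forall>i. \<forall>y\<in>{0..1}. X i y = Y i y))"
proof -
  have width: "\<gamma>0 < width \<alpha> \<beta> t" "width \<alpha> \<beta> t < \<gamma>1" if "t \<in> {0..T}" for t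
    using assms(7) that by auto
  have \<gamma>1: "0 < \<gamma>1" using width[of 0] \<open>0 < T\<close> \<open>0 < \<gamma>0\<close> by simp
  define B where "B = (\<alpha>max + \<gamma>max) / \<gamma>0"
  have b1: "\<bar>coeff_b1 T \<alpha> \<beta> y t\<bar> \<le> B" if "t \<in> {0..T}" "y \<in> {0..1}" for t y
    unfolding B_def using assms that by (intro coeff_b1_bound) auto
  obtain Lf where Lf: "\<And>i. (Lf i)-lipschitz_on UNIV (a i)" using assms(13) by metis
  \<comment> \<open>One constant for all components; the constants are nonnegative, so their sum
    dominates each. The sums of \<open>K0\<close> and \<open>K1\<close> below serve the same
    purpose.\<close>
  define L where "L = sum Lf UNIV"
  have Lf0: "0 \<le> Lf i" for i using lipschitz_on_nonneg[OF Lf] .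
  have L: "\<bar>a i s - a i r\<bar> \<le> L * norm (s - r)" for i s r
  proof -
    have "\<bar>a i s - a i r\<bar> \<le> Lf i * norm (s - r)"
      using lipschitz_onD[OF Lf, of s r i] by (simp add: dist_norm)
    also have "\<dots> \<le> L * norm (s - r)"
      unfolding L_def using Lf0 by (intro mult_right_mono member_le_sum) auto
    finally show ?thesis .
  qed
  have "\<alpha> 0 < \<beta> 0" using width[of 0] \<open>0 < T\<close> \<open>0 < \<gamma>0\<close> by (simp add: width_def)
  then have "\<forall>i. \<exists>K\<ge>0. \<forall>M x V. mesh M x \<longrightarrow>
      lagrange_interpolant k \<xi> M x (init_v \<alpha> \<beta> (u0 i)) V \<longrightarrow> L2_inner (deriv V) (deriv V) \<le> K"
    using lagrange_interpolant_energy[OF assms(17)] assms(10) by blast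
  then obtain K0 where K0: "\<And>i. 0 \<le> K0 i" "\<And>i M x V. mesh M x \<Longrightarrow>
      lagrange_interpolant k \<xi> M x (init_v \<alpha> \<beta> (u0 i)) V \<Longrightarrow> L2_inner (deriv V) (deriv V) \<le> K0 i"
    by metis
  obtain K1 where K1: "\<And>i N. (\<Sum>n=1..N. T / real N *
        (LINT y:{0<..<1}|lebesgue. (source_g \<alpha> \<beta> (f i) y (real n * (T / real N)))\<^sup>2)) \<le> K1 i"
    using assms(12) unfolding L2_time_samples_def by metis
  have K1_nonneg: "0 \<le> K1 i" for i using K1[of 0 i] by simp
  have gL2: "L2_on {0<..<1} (\<lambda>y. source_g \<alpha> \<beta> (f i) y (real n * (T / real N)))" if "n \<in> {1..N}" for i n N
    using assms(12) that unfolding L2_time_samples_def by blast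
  define C where "C = \<gamma>1\<^sup>2 / m\<^sub>a * (B\<^sup>2 + 1)"
  define R where "R = exp (2 * C * T) * (sum K0 UNIV + C * sum K1 UNIV)"
  define \<kappa>0 where "\<kappa>0 = m\<^sub>a / \<gamma>1\<^sup>2"
  \<comment> \<open>Factor by factor: \<open>1 / \<gamma>0\<^sup>2\<close> bounds \<open>b2\<close>,
    \<open>L\<close> is the Lipschitz constant, \<open>\<gamma>1\<close> bounds the nonlocal
    functional in L2, and \<open>R\<close> bounds the energy of each component of
    \<open>Y\<close>.\<close>
  define q where "q = (L * \<gamma>1 / \<gamma>0\<^sup>2)\<^sup>2 * R"
  \<comment> \<open>Chosen so that the component estimates, summed over all \<open>CARD('n)\<close>
    components, read \<open>S \<le> D * \<delta> * S\<close>.\<close>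
  define D where "D = (real CARD('n) * q + B\<^sup>2) / (2 * \<kappa>0)"
  \<comment> \<open>Meets both demands at once: \<open>C * \<delta> \<le> 1 / 2\<close> for Gronwall
    and \<open>D * \<delta> < 1\<close> for the final contraction. The summand 1 keeps the
    denominator positive.\<close>
  define \<delta>0 where "\<delta>0 = 1 / (2 * (C + D + 1))"
  have C0: "0 \<le> C" and \<kappa>0: "0 < \<kappa>0" using \<open>0 < m\<^sub>a\<close> \<gamma>1 by (auto simp: C_def \<kappa>0_def)
  have R0: "0 \<le> R"
    unfolding R_def using C0 by (auto intro!: mult_nonneg_nonneg add_nonneg_nonneg sum_nonneg K0 K1_nonneg)
  then have D0: "0 \<le> D" using \<kappa>0 by (simp add: D_def q_def)
  show ?thesis
  proof (intro exI[of _ \<delta>0] conjI allI impI ballI)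
    show "0 < \<delta>0" using C0 D0 by (simp add: \<delta>0_def)
    fix M x N \<delta> n V X Y i y
    assume H: "mesh M x \<and> 0 < \<delta> \<and> T = real N * \<delta> \<and> \<delta> \<le> \<delta>0 \<and>
           c1 * (mesh_size M x)\<^sup>2 \<le> \<delta> \<and> \<delta> \<le> c2 * (mesh_size M x)\<^sup>2"
      and n: "n < N" and E: "(\<forall>i. lagrange_interpolant k \<xi> M x (init_v \<alpha> \<beta> (u0 i)) (V 0 i)) \<and>
              (\<forall>m<n. euler_step T \<alpha> \<beta> a f (fe_space k M x) \<delta> m (V m) (V (Suc m))) \<and>
              euler_step T \<alpha> \<beta> a f (fe_space k M x) \<delta> n (V n) X \<and>
              euler_step T \<alpha> \<beta> a f (fe_space k M x) \<delta> n (V n) Y"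
      and y: "y \<in> {0..1::real}"
    have M: "mesh M x" and \<delta>: "0 < \<delta>" "T = real N * \<delta>" "\<delta> \<le> \<delta>0" using H by auto
    let ?S = "fe_space k M x"
    have V0: "V 0 j \<in> ?S" "L2_inner (deriv (V 0 j)) (deriv (V 0 j)) \<le> K0 j" for j
      using E K0(2)[OF M] by (auto simp: lagrange_interpolant_def)
    have stepV: "euler_step T \<alpha> \<beta> a f ?S \<delta> m (V m) (V (Suc m))" if "m < n" for m
      using E that by blast
    have stepX: "euler_step T \<alpha> \<beta> a f ?S \<delta> n (V n) X" and stepY: "euler_step T \<alpha> \<beta> a f ?S \<delta> n (V n) Y"
      using E by auto
    have Vn: "V n j \<in> ?S" for j
      using V0 stepV by (cases n) (auto simp: euler_step_def)
    have XS: "X j \<in> ?S" and YS: "Y j \<in> ?S" for j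
      using stepX stepY by (auto simp: euler_step_def)
    have "\<delta> * (2 * (C + D + 1)) \<le> 1"
      using \<delta>(3) C0 D0 by (simp add: \<delta>0_def le_divide_eq)
    then have CD: "C * \<delta> + D * \<delta> + \<delta> \<le> 1 / 2" by (simp add: algebra_simps)
    moreover have "0 \<le> C * \<delta>" "0 \<le> D * \<delta>" using C0 D0 \<delta> by auto
    ultimately have C\<delta>: "C * \<delta> \<le> 1 / 2" and D\<delta>: "D * \<delta> < 1" using \<delta>(1) by linarith+
    have Y_energy: "L2_inner (deriv (Y j)) (deriv (Y j)) \<le> R" for j
    proof -
      \<comment> \<open>Appending \<open>Y\<close> to the given levels yields a chain of
        \<open>Suc n\<close> steps, so the energy bound reaches the competitor itself.\<close>
      define V' where "V' = V(Suc n := Y)"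
      have "euler_step T \<alpha> \<beta> a f ?S \<delta> m (V' m) (V' (Suc m))" if "m < Suc n" for m
        using that stepV stepY by (cases "m = n") (auto simp: V'_def)
      then have "L2_inner (deriv (V' (Suc n) j)) (deriv (V' (Suc n) j)) \<le>
        exp (2 * C * T) * (L2_inner (deriv (V' 0 j)) (deriv (V' 0 j)) + C * K1 j)"
        using n V0 assms(15) width stepV stepY
        by (intro euler_energy_bound[where a = a, OF \<open>0 < \<gamma>0\<close> _ b1 \<open>0 < m\<^sub>a\<close> _
               gL2 K1 C_def M \<delta>(1,2) C\<delta>])
          (auto simp: V'_def)
      also have "\<dots> \<le> R"
        unfolding R_def
      proof (intro mult_left_mono add_mono C0)
        have "L2_inner (deriv (V' 0 j)) (deriv (V' 0 j)) \<le> K0 j" using V0 by (simp add: V'_def)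
        also have "\<dots> \<le> sum K0 UNIV" by (intro member_le_sum) (auto simp: K0)
        finally show "L2_inner (deriv (V' 0 j)) (deriv (V' 0 j)) \<le> sum K0 UNIV" .
        show "K1 j \<le> sum K1 UNIV" by (intro member_le_sum) (auto simp: K1_nonneg)
      qed simp
      finally show ?thesis by (simp add: V'_def)
    qed
    define t where "t = real (Suc n) * \<delta>"
    have "real (Suc n) \<le> real N" using n by simp
    then have t: "t \<in> {0..T}" unfolding t_def \<delta>(2) using \<delta>(1) by (auto intro: mult_right_mono)
    define b2 where "b2 = coeff_b2 \<alpha> \<beta> t"
    have "\<gamma>0\<^sup>2 \<le> (width \<alpha> \<beta> t)\<^sup>2" "(width \<alpha> \<beta> t)\<^sup>2 \<le> \<gamma>1\<^sup>2"
      using width[OF t] \<open>0 < \<gamma>0\<close> by (auto intro!: power_mono)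
    then have b2: "1 / \<gamma>1\<^sup>2 \<le> b2" "b2 \<le> 1 / \<gamma>0\<^sup>2" "0 \<le> b2"
      using width[OF t] \<open>0 < \<gamma>0\<close> by (auto simp: b2_def coeff_b2_def intro!: frac_le)
    define lX where "lX = (\<chi> j. nonlocal_l \<alpha> \<beta> t (X j))"
    define lY where "lY = (\<chi> j. nonlocal_l \<alpha> \<beta> t (Y j))"
    \<comment> \<open>No component can be closed on its own, since the coefficient of each depends
      on all of them; the estimate is closed for the sum \<open>S\<close>.\<close>
    define e where "e j = (LINT y:{0<..<1}|lebesgue. (X j y - Y j y)\<^sup>2)" for j
    define S where "S = sum e UNIV"
    have e0: "0 \<le> e j" for j unfolding e_def by (rule set_integral_nonneg_real) simp
    have S0: "0 \<le> S" unfolding S_def by (simp add: e0 sum_nonneg)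
    have "(norm (lX - lY))\<^sup>2 = (\<Sum>j\<in>UNIV. (nonlocal_l \<alpha> \<beta> t (X j) - nonlocal_l \<alpha> \<beta> t (Y j))\<^sup>2)"
      unfolding norm_vec_def L2_set_def by (simp add: sum_nonneg lX_def lY_def)
    also have "\<dots> \<le> (\<Sum>j\<in>UNIV. \<gamma>1\<^sup>2 * e j)"
    proof (rule sum_mono)
      fix j
      have "(nonlocal_l \<alpha> \<beta> t (X j) - nonlocal_l \<alpha> \<beta> t (Y j))\<^sup>2 \<le> (width \<alpha> \<beta> t)\<^sup>2 * e j"
        unfolding e_def by (intro nonlocal_l_diff_square_le fe_space_continuous_on[OF XS] fe_space_continuous_on[OF YS])
      also have "\<dots> \<le> \<gamma>1\<^sup>2 * e j"
        using \<open>(width \<alpha> \<beta> t)\<^sup>2 \<le> \<gamma>1\<^sup>2\<close> e0 by (intro mult_right_mono)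
      finally show "(nonlocal_l \<alpha> \<beta> t (X j) - nonlocal_l \<alpha> \<beta> t (Y j))\<^sup>2 \<le> \<gamma>1\<^sup>2 * e j" .
    qed
    finally have l: "(norm (lX - lY))\<^sup>2 \<le> \<gamma>1\<^sup>2 * S" by (simp add: S_def sum_distrib_left)
    have comp: "e j \<le> \<delta> / (2 * \<kappa>0) * (q * S + B\<^sup>2 * e j)" for j
    proof -
      have ZS: "(\<lambda>y. X j y - Y j y) \<in> ?S" by (rule fe_space_diff[OF XS YS])
      have "\<kappa>0 \<le> b2 * a j lX"
        using mult_mono[OF b2(1), of m\<^sub>a "a j lX"] assms(15) \<open>0 < m\<^sub>a\<close> b2 by (simp add: \<kappa>0_def)
      then have "e j \<le> \<delta> / (2 * \<kappa>0) *
          ((b2 * a j lX - b2 * a j lY)\<^sup>2 * L2_inner (deriv (Y j)) (deriv (Y j)) + B\<^sup>2 * e j)"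
        unfolding e_def
      proof (rule euler_component_difference[OF M XS YS Vn \<delta>(1) \<kappa>0 _
            piecewise_poly_coeff_b1[of M x T \<alpha> \<beta> t]])
        show "L2_inner (\<lambda>y. (X j y - V n j y) / \<delta>) (\<lambda>y. X j y - Y j y)
          + b2 * a j lX * L2_inner (deriv (X j)) (deriv (\<lambda>y. X j y - Y j y))
          - L2_inner (\<lambda>y. coeff_b1 T \<alpha> \<beta> y t * deriv (X j) y) (\<lambda>y. X j y - Y j y)
          = L2_inner (\<lambda>y. source_g \<alpha> \<beta> (f j) y t) (\<lambda>y. X j y - Y j y)"
          using stepX ZS by (simp add: euler_step_def Let_def b2_def t_def lX_def)
        show "L2_inner (\<lambda>y. (Y j y - V n j y) / \<delta>) (\<lambda>y. X j y - Y j y)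
          + b2 * a j lY * L2_inner (deriv (Y j)) (deriv (\<lambda>y. X j y - Y j y))
          - L2_inner (\<lambda>y. coeff_b1 T \<alpha> \<beta> y t * deriv (Y j) y) (\<lambda>y. X j y - Y j y)
          = L2_inner (\<lambda>y. source_g \<alpha> \<beta> (f j) y t) (\<lambda>y. X j y - Y j y)"
          using stepY ZS by (simp add: euler_step_def Let_def b2_def t_def lY_def)
      qed (use b1 t in auto)
      also have "\<dots> \<le> \<delta> / (2 * \<kappa>0) * (q * S + B\<^sup>2 * e j)"
      proof (intro mult_left_mono add_right_mono)
        have "(a j lX - a j lY)\<^sup>2 \<le> (L * norm (lX - lY))\<^sup>2"
          using power_mono[OF L[of j lX lY], of 2] by simp
        also have "\<dots> \<le> L\<^sup>2 * (\<gamma>1\<^sup>2 * S)"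
          unfolding power_mult_distrib using l by (intro mult_left_mono) auto
        finally have aL: "(a j lX - a j lY)\<^sup>2 \<le> L\<^sup>2 * (\<gamma>1\<^sup>2 * S)" .
        have "(b2 * a j lX - b2 * a j lY)\<^sup>2 = b2\<^sup>2 * (a j lX - a j lY)\<^sup>2"
          by (simp add: power_mult_distrib[symmetric] algebra_simps)
        also have "\<dots> \<le> (1 / \<gamma>0\<^sup>2)\<^sup>2 * (L\<^sup>2 * (\<gamma>1\<^sup>2 * S))"
          using b2 aL by (intro mult_mono power_mono) auto
        also have "\<dots> = (L * \<gamma>1 / \<gamma>0\<^sup>2)\<^sup>2 * S"
          by (simp add: power_mult_distrib power_divide)
        finally have "(b2 * a j lX - b2 * a j lY)\<^sup>2 * L2_inner (deriv (Y j)) (deriv (Y j)) \<le>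
            (L * \<gamma>1 / \<gamma>0\<^sup>2)\<^sup>2 * S * R"
          using Y_energy S0 by (intro mult_mono) (auto simp: L2_inner_self_nonneg)
        then show "(b2 * a j lX - b2 * a j lY)\<^sup>2 * L2_inner (deriv (Y j)) (deriv (Y j)) \<le> q * S"
          by (simp add: q_def mult_ac)
      qed (use \<delta> \<kappa>0 in simp)
      finally show ?thesis .
    qed
    have "S \<le> (\<Sum>j\<in>UNIV. \<delta> / (2 * \<kappa>0) * (q * S + B\<^sup>2 * e j))"
      unfolding S_def by (rule sum_mono) (use comp in \<open>simp add: S_def\<close>)
    also have "\<dots> = D * \<delta> * S"
    proof -
      have "(\<Sum>j\<in>UNIV. q * S + B\<^sup>2 * e j) = real CARD('n) * q * S + B\<^sup>2 * S"
        by (simp add: sum.distrib sum_distrib_left[symmetric] S_def[symmetric])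
      then show ?thesis
        unfolding sum_distrib_left[symmetric] D_def by (simp add: algebra_simps add_divide_distrib)
    qed
    finally have "S * (1 - D * \<delta>) \<le> 0" by (simp add: algebra_simps)
    then have "S \<le> 0" using D\<delta> by (simp add: mult_le_0_iff)
    moreover have "e i \<le> S" unfolding S_def by (intro member_le_sum) (auto simp: e0)
    ultimately have "(LINT y:{0<..<1}|lebesgue. (X i y - Y i y)\<^sup>2) \<le> 0"
      by (simp add: e_def)
    then show "X i y = Y i y"
      using continuous_square_integral_zero[of 0 1 "\<lambda>y. X i y - Y i y" y] y
        continuous_on_diff[OF fe_space_continuous_on[OF XS] fe_space_continuous_on[OF YS]] by simp
  qed
qed

end
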